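(* Let $n\ge 3$ be an integer and let $X_1,X_2,\ldots,X_n$ be independent, identically distributed positive random variables whose common distribution $F$ has a density $f$ that is positive and continuous on $(0,\infty)$. Let $X_{(1)}\le X_{(2)}\le\cdots\le X_{(n)}$ be the order statistics and $\overline{X}_n=\frac1n\sum_{i=1}^n X_i$ the sample mean. Let $a_1\le a_2\le\cdots\le a_n$ be real numbers, not all equal, and define $$Z_n=\sum_{i=1}^n a_i\big(X_{(i)}-\overline{X}_n\big).$$ Then $\overline{X}_n$ and $Z_n/\overline{X}_n$ are independent if and only if $F$ is a gamma distribution.
   Context: A distribution $F$ is a gamma distribution if, for some $a>0$ and $b>0$, it is absolutely continuous with density $\frac{1}{\Gamma(a)b^a}x^{a-1}e^{-x/b}$ for $x>0$ and $0$ for $x\le 0$. *)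

theory Defs
  imports "HOL-Probability.Probability"
begin

definition gamma_density :: "real \<Rightarrow> real \<Rightarrow> real \<Rightarrow> real" where
  "gamma_density a b x =
     (if 0 < x then 1 / (Gamma a * b powr a) * x powr (a - 1) * exp (- x / b) else 0)"

definition gamma_distribution :: "real measure \<Rightarrow> bool" where
  "gamma_distribution F \<longleftrightarrow>
     (\<exists>a>0. \<exists>b>0. F = density lborel (\<lambda>x. ennreal (gamma_density a b x)))"

text \<open>Samples are indexed by \<open>1, \<dots>, n\<close>; \<open>order_stat n X k\<close> is meaningful for \<open>1 \<le> k \<le> n\<close>.\<close>

definition order_stat :: "nat \<Rightarrow> (nat \<Rightarrow> 'a \<Rightarrow> real) \<Rightarrow> nat \<Rightarrow> 'a \<Rightarrow> real" where
  "order_stat n X k \<omega> = sort (map (\<lambda>i. X i \<omega>) [1..<n + 1]) ! (k - 1)"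

definition sample_mean :: "nat \<Rightarrow> (nat \<Rightarrow> 'a \<Rightarrow> real) \<Rightarrow> 'a \<Rightarrow> real" where
  "sample_mean n X \<omega> = (\<Sum>i = 1..n. X i \<omega>) / real n"

definition L_stat ::
  "nat \<Rightarrow> (nat \<Rightarrow> real) \<Rightarrow> (nat \<Rightarrow> 'a \<Rightarrow> real) \<Rightarrow> 'a \<Rightarrow> real" where
  "L_stat n a X \<omega> = (\<Sum>i = 1..n. a i * (order_stat n X i \<omega> - sample_mean n X \<omega>))"

end

theory Submission
  imports Defs
begin

text \<open>
  The law of the sample is studied in polar coordinates \<open>y = r \<omega>\<close>, where \<open>r\<close> is the mean of \<open>y\<close>
  and \<open>\<omega>\<close>, a positive vector of mean 1, is its direction. Lebesgue measure on the orthant becomes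
  \<open>r\<^sup>n\<^sup>-\<^sup>1 dr \<sigma>(d\<omega>)\<close> for a finite measure \<open>\<sigma>\<close> (lemma \<open>polar_coordinates\<close>). The ratio \<open>T\<close> of \<open>Z\<close> and
  the mean depends on \<open>\<omega>\<close> only, so (lemma \<open>joint_law\<close>) on the event \<open>T \<in> D\<close> the mean has the density
  \<open>r\<^sup>n\<^sup>-\<^sup>1 G\<^sub>D(r)\<close>, where \<open>G\<^sub>D(r)\<close> is the integral of \<open>\<Prod>\<^sub>i f(r \<omega>\<^sub>i)\<close> over the directions with
  \<open>T(\<omega>) \<in> D\<close>.

  If \<open>f\<close> is a gamma density, the product splits into a function of \<open>r\<close> and a function of \<open>\<omega>\<close>,
  because \<open>\<Sum>\<^sub>i \<omega>\<^sub>i = n\<close>; this gives independence.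

  Conversely, let the mean and \<open>T\<close> be independent, and write \<open>G\<^sub>\<epsilon>\<close> for the integral over \<open>T \<le> \<epsilon>\<close>.
  Independence makes all the functions \<open>G\<^sub>\<epsilon>\<close> proportional to each other. For small \<open>\<epsilon>\<close> the condition
  \<open>T \<le> \<epsilon>\<close> forces all \<open>\<omega>\<^sub>i\<close> to be close to 1, since \<open>Z\<close> dominates a positive multiple of the sample
  range. Hence \<open>G\<^sub>\<epsilon>(r) / \<sigma>(T \<le> \<epsilon>)\<close> tends to \<open>f(r)\<^sup>n\<close>, and every single \<open>G\<^sub>\<epsilon>\<close> is a constant multiple of
  \<open>f\<^sup>n\<close>.

  The density is only continuous, so this identity cannot be differentiated. It is instead compared
  with the functions \<open>p z + q - A ln z\<close>, the logarithms of gamma-type densities, for which the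
  identity holds exactly: if \<open>ln f\<close> equals such a function, then \<open>G\<^sub>\<epsilon>(r) / f(r)\<^sup>n\<close> is the integral of
  \<open>exp(A \<Lambda>)\<close> over \<open>T \<le> \<epsilon>\<close>, where \<open>\<Lambda>(\<omega>) = - \<Sum>\<^sub>i ln \<omega>\<^sub>i\<close>. By the inequality between the arithmetic
  and the geometric mean, \<open>\<Lambda>\<close> is positive outside the diagonal, and the integral is strictly
  increasing in \<open>A\<close>. If \<open>ln f\<close> is touched from above at one point by such a function with parameter
  \<open>A\<close>, and from below at another point by one with parameter \<open>A'\<close>, then small \<open>\<epsilon>\<close> gives \<open>A' \<le> A\<close>.

  Through any three points of the graph of \<open>ln f\<close> passes exactly one function \<open>p z + q - A ln z\<close>. The
  difference of the two vanishes at three points, so it has an interior maximum and an interior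
  minimum: the parameter \<open>A\<close> of the interpolant occurs in a touching from above and in one from below.
  By the preceding inequality any two triples have the same \<open>A\<close>, so \<open>ln f\<close> itself has the form
  \<open>p z + q - A ln z\<close> (lemma \<open>gamma_log_if_touching_ordered\<close>). Integrability of \<open>f\<close> near 0 and near
  infinity gives \<open>A < 1\<close> and \<open>p < 0\<close>, and \<open>F\<close> is a gamma distribution.
\<close>

section \<open>Order statistics and linear combinations of them\<close>

lemma sorted_nth_le_iff:
  fixes ys :: "real list"
  assumes "sorted ys" "j < length ys"
  shows "ys ! j \<le> t \<longleftrightarrow> j < length (filter (\<lambda>x. x \<le> t) ys)"
proof
  assume le: "ys ! j \<le> t"
  have "\<forall>x\<in>set (take (Suc j) ys). x \<le> t"
  proof
    fix x assume "x \<in> set (take (Suc j) ys)"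
    then obtain i where "i < Suc j" "i < length ys" "x = ys ! i"
      by (auto simp: in_set_conv_nth)
    then show "x \<le> t"
      using sorted_nth_mono[OF assms(1), of i j] assms(2) le by simp
  qed
  then have "filter (\<lambda>x. x \<le> t) (take (Suc j) ys) = take (Suc j) ys"
    by (simp add: filter_id_conv)
  then have "length (filter (\<lambda>x. x \<le> t) (take (Suc j) ys @ drop (Suc j) ys)) \<ge> Suc j"
    using assms(2) by (simp only: filter_append length_append) simp
  then show "j < length (filter (\<lambda>x. x \<le> t) ys)" by simp
next
  assume lt: "j < length (filter (\<lambda>x. x \<le> t) ys)"
  show "ys ! j \<le> t"
  proof (rule ccontr)
    assume gt: "\<not> ys ! j \<le> t"
    have "\<not> x \<le> t" if x: "x \<in> set (drop j ys)" for x
    proof -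
      obtain i where "i < length (drop j ys)" "x = drop j ys ! i"
        using x unfolding in_set_conv_nth by metis
      then have "x = ys ! (j + i)" "j + i < length ys" by auto
      then show ?thesis
        using sorted_nth_mono[OF assms(1), of j "j + i"] gt by simp
    qed
    then have "filter (\<lambda>x. x \<le> t) (drop j ys) = []"
      by (auto simp: filter_empty_conv)
    then have "length (filter (\<lambda>x. x \<le> t) (take j ys @ drop j ys)) \<le> j"
      unfolding filter_append using length_filter_le[of _ "take j ys"]
      by (simp add: order_trans)
    with lt show False by simp
  qed
qed

text \<open>
  The distribution-function view of order statistics. Measurability and scaling both follow from
  it without any reference to sorting.
\<close>

lemma order_stat_le_iff:
  assumes "k \<in> {1..n}"
  shows "order_stat n X k \<omega> \<le> t \<longleftrightarrow> k \<le> card {i \<in> {1..n}. X i \<omega> \<le> t}"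
proof -
  let ?xs = "map (\<lambda>i. X i \<omega>) [1..<n + 1]"
  have "length (filter (\<lambda>x. x \<le> t) (sort ?xs)) = length (filter (\<lambda>x. x \<le> t) ?xs)"
    by (metis mset_filter mset_sort size_mset)
  also have "\<dots> = card (set (filter (\<lambda>i. X i \<omega> \<le> t) [1..<n + 1]))"
    by (subst distinct_card) (simp_all add: filter_map o_def del: upt_Suc)
  also have "set (filter (\<lambda>i. X i \<omega> \<le> t) [1..<n + 1]) = {i \<in> {1..n}. X i \<omega> \<le> t}"
    by auto
  finally have "length (filter (\<lambda>x. x \<le> t) (sort ?xs)) = card {i \<in> {1..n}. X i \<omega> \<le> t}" .
  moreover have "order_stat n X k \<omega> \<le> t \<longleftrightarrow> k - 1 < length (filter (\<lambda>x. x \<le> t) (sort ?xs))"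
    unfolding order_stat_def using assms by (intro sorted_nth_le_iff) (auto simp del: upt_Suc)
  ultimately show ?thesis
    using assms by auto
qed

lemma measurable_order_stat:
  assumes "k \<in> {1..n}" and [measurable]: "\<And>i. i \<in> {1..n} \<Longrightarrow> X i \<in> borel_measurable M"
  shows "order_stat n X k \<in> borel_measurable M"
  unfolding borel_measurable_iff_le
proof
  fix t
  have "card {i \<in> {1..n}. X i \<omega> \<le> t} = (\<Sum>i\<in>{1..n}. if X i \<omega> \<le> t then 1 else 0)" for \<omega>
    by (simp add: sum.If_cases Int_def conj_commute)
  then have "{\<omega> \<in> space M. order_stat n X k \<omega> \<le> t} =
      {\<omega> \<in> space M. k \<le> (\<Sum>i\<in>{1..n}. if X i \<omega> \<le> t then 1 else 0)}"
    by (simp only: order_stat_le_iff[OF assms(1)])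
  also have "\<dots> \<in> sets M" by measurable
  finally show "{\<omega> \<in> space M. order_stat n X k \<omega> \<le> t} \<in> sets M" .
qed

lemma order_stat_scale:
  assumes "k \<in> {1..n}" "0 < c" "\<And>i. i \<in> {1..n} \<Longrightarrow> Y i \<eta> = c * X i \<omega>"
  shows "order_stat n Y k \<eta> = c * order_stat n X k \<omega>"
proof -
  have "order_stat n Y k \<eta> \<le> t \<longleftrightarrow> c * order_stat n X k \<omega> \<le> t" for t
  proof -
    have "{i \<in> {1..n}. Y i \<eta> \<le> t} = {i \<in> {1..n}. X i \<omega> \<le> t / c}"
      using assms by (auto simp: field_simps)
    then have "order_stat n Y k \<eta> \<le> t \<longleftrightarrow> order_stat n X k \<omega> \<le> t / c"
      by (simp only: order_stat_le_iff[OF assms(1)])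
    then show ?thesis
      using assms(2) by (simp add: field_simps)
  qed
  from this[of "order_stat n Y k \<eta>"] this[of "c * order_stat n X k \<omega>"]
  show ?thesis by simp
qed

lemma order_stat_mono:
  assumes "1 \<le> i" "i \<le> j" "j \<le> n"
  shows "order_stat n X i \<omega> \<le> order_stat n X j \<omega>"
  unfolding order_stat_def using assms by (intro sorted_nth_mono) (auto simp del: upt_Suc)

lemma sum_order_stat: "(\<Sum>k = 1..n. order_stat n X k \<omega>) = (\<Sum>i = 1..n. X i \<omega>)"
proof -
  let ?xs = "map (\<lambda>i. X i \<omega>) [1..<n + 1]"
  have "(\<Sum>k = 1..n. order_stat n X k \<omega>) = (\<Sum>k = 0..<n. sort ?xs ! k)"
    unfolding order_stat_def
    by (rule sum.reindex_bij_witness[of _ Suc "\<lambda>k. k - 1"]) auto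
  also have "\<dots> = sum_list (sort ?xs)"
    by (simp add: sum_list_sum_nth del: upt_Suc)
  also have "\<dots> = sum_list ?xs"
    by (metis mset_sort sum_mset_sum_list)
  also have "\<dots> = (\<Sum>i = 1..n. X i \<omega>)"
    by (simp add: sum_list_distinct_conv_sum_set atLeastLessThanSuc_atLeastAtMost del: upt_Suc)
  finally show ?thesis .
qed

lemma order_stat_in_image:
  assumes "k \<in> {1..n}"
  shows "order_stat n X k \<omega> \<in> (\<lambda>i. X i \<omega>) ` {1..n}"
proof -
  let ?xs = "map (\<lambda>i. X i \<omega>) [1..<n + 1]"
  have "sort ?xs ! (k - 1) \<in> set (sort ?xs)"
    using assms by (intro nth_mem) (auto simp del: upt_Suc)
  then show ?thesis unfolding order_stat_def by auto
qed

lemma between_extreme_order_stats: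
  assumes "i \<in> {1..n}"
  shows "order_stat n X 1 \<omega> \<le> X i \<omega>" "X i \<omega> \<le> order_stat n X n \<omega>"
proof -
  let ?xs = "map (\<lambda>i. X i \<omega>) [1..<n + 1]"
  have "X i \<omega> \<in> set (sort ?xs)" using assms by (auto simp del: upt_Suc)
  then obtain j where j: "j < length (sort ?xs)" "sort ?xs ! j = X i \<omega>"
    unfolding in_set_conv_nth by blast
  then have "X i \<omega> = order_stat n X (Suc j) \<omega>" "Suc j \<le> n"
    unfolding order_stat_def by (auto simp del: upt_Suc)
  then show "order_stat n X 1 \<omega> \<le> X i \<omega>" "X i \<omega> \<le> order_stat n X n \<omega>"
    using order_stat_mono[of 1 "Suc j" n X \<omega>] order_stat_mono[of "Suc j" n n X \<omega>] by auto
qed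

text \<open>
  With \<open>b\<close> the sorted sample and \<open>m\<close> its mean, Chebyshev's identity reads
  \<open>\<Sum>\<^sub>i\<^sub>j (a\<^sub>i - a\<^sub>j) (b\<^sub>i - b\<^sub>j) = 2 n \<Sum>\<^sub>i a\<^sub>i (b\<^sub>i - m)\<close>. Both sequences increase, so each summand on the
  left is nonnegative, and the two extreme pairs alone give the bound.
\<close>

lemma spread_le_L_stat:
  assumes "2 \<le> n" "mono_on {1..n} a"
  shows "(a n - a 1) * (order_stat n X n \<omega> - order_stat n X 1 \<omega>) \<le> real n * L_stat n a X \<omega>"
proof -
  define b where "b = (\<lambda>k. order_stat n X k \<omega>)"
  have mono: "b i \<le> b j" if "i \<in> {1..n}" "j \<in> {1..n}" "i \<le> j" for i j
    using order_stat_mono that by (simp add: b_def)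
  have nonneg: "0 \<le> (a i - a j) * (b i - b j)" if "i \<in> {1..n}" "j \<in> {1..n}" for i j
  proof (cases "i \<le> j")
    case True
    then show ?thesis
      using mono[OF that True] monotone_onD[OF assms(2) that True] by (simp add: mult_nonpos_nonpos)
  next
    case False
    then show ?thesis
      using mono[OF that(2,1)] monotone_onD[OF assms(2) that(2,1)] by simp
  qed
  define g where "g = (\<lambda>(i, j). (a i - a j) * (b i - b j))"
  have "2 * ((a n - a 1) * (b n - b 1)) = sum g {(n, 1), (1, n)}"
    using assms(1) by (simp add: g_def algebra_simps)
  also have "\<dots> \<le> sum g ({1..n} \<times> {1..n})"
    using assms(1) nonneg by (intro sum_mono2) (auto simp: g_def)
  also have "\<dots> = (\<Sum>i = 1..n. \<Sum>j = 1..n. (a i - a j) * (b i - b j))"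
    by (simp add: g_def sum.cartesian_product)
  also have "\<dots> = 2 * (real n * (\<Sum>i = 1..n. a i * b i) - (\<Sum>i = 1..n. a i) * (\<Sum>i = 1..n. b i))"
    by (simp add: algebra_simps sum.distrib sum_subtractf sum_distrib_left sum_distrib_right
        sum.swap[of "\<lambda>i j. a i * b j"])
  also have "(\<Sum>i = 1..n. b i) = real n * sample_mean n X \<omega>"
    using assms(1) sum_order_stat[of n X \<omega>] by (simp add: b_def sample_mean_def)
  also have "real n * (\<Sum>i = 1..n. a i * b i) - (\<Sum>i = 1..n. a i) * (real n * sample_mean n X \<omega>)
      = real n * L_stat n a X \<omega>"
    by (simp add: L_stat_def b_def algebra_simps sum_subtractf sum_distrib_left)
  finally show ?thesis by (simp add: b_def)
qed

lemma sample_mean_between: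
  assumes "0 < n" "\<And>i. i \<in> {1..n} \<Longrightarrow> lo \<le> X i \<omega>" "\<And>i. i \<in> {1..n} \<Longrightarrow> X i \<omega> \<le> hi"
  shows "lo \<le> sample_mean n X \<omega>" "sample_mean n X \<omega> \<le> hi"
proof -
  have "(\<Sum>i = 1..n. lo) \<le> (\<Sum>i = 1..n. X i \<omega>)" "(\<Sum>i = 1..n. X i \<omega>) \<le> (\<Sum>i = 1..n. hi)"
    by (intro sum_mono assms(2), assumption, intro sum_mono assms(3), assumption)
  then show "lo \<le> sample_mean n X \<omega>" "sample_mean n X \<omega> \<le> hi"
    using assms(1) by (simp_all add: sample_mean_def field_simps)
qed

text \<open>
  This and \<open>spread_le_L_stat\<close> say that the statistic is comparable with the sample range.
\<close>

lemma L_stat_le_spread: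
  assumes "0 < n" "\<And>i. i \<in> {1..n} \<Longrightarrow> lo \<le> X i \<omega>" "\<And>i. i \<in> {1..n} \<Longrightarrow> X i \<omega> \<le> hi"
  shows "L_stat n a X \<omega> \<le> (\<Sum>i = 1..n. \<bar>a i\<bar>) * (hi - lo)"
proof -
  have "a k * (order_stat n X k \<omega> - sample_mean n X \<omega>) \<le> \<bar>a k\<bar> * (hi - lo)" if k: "k \<in> {1..n}" for k
  proof -
    have "lo \<le> order_stat n X k \<omega>" "order_stat n X k \<omega> \<le> hi"
      using order_stat_in_image[OF k, of X \<omega>] assms by auto
    then have "\<bar>order_stat n X k \<omega> - sample_mean n X \<omega>\<bar> \<le> hi - lo"
      using sample_mean_between[where X = X and \<omega> = \<omega>, OF assms] by auto
    then have "\<bar>a k * (order_stat n X k \<omega> - sample_mean n X \<omega>)\<bar> \<le> \<bar>a k\<bar> * (hi - lo)"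
      by (simp add: abs_mult mult_left_mono)
    then show ?thesis by simp
  qed
  then show ?thesis
    unfolding L_stat_def sum_distrib_right by (rule sum_mono)
qed

lemma sample_mean_scale:
  assumes "\<And>i. i \<in> {1..n} \<Longrightarrow> Y i \<eta> = c * X i \<omega>"
  shows "sample_mean n Y \<eta> = c * sample_mean n X \<omega>"
proof -
  have "(\<Sum>i = 1..n. Y i \<eta>) = c * (\<Sum>i = 1..n. X i \<omega>)"
    using assms by (simp add: sum_distrib_left)
  then show ?thesis by (simp add: sample_mean_def)
qed

lemma L_stat_scale:
  assumes "0 < c" "\<And>i. i \<in> {1..n} \<Longrightarrow> Y i \<eta> = c * X i \<omega>"
  shows "L_stat n a Y \<eta> = c * L_stat n a X \<omega>"
proof -
  have "a k * (order_stat n Y k \<eta> - sample_mean n Y \<eta>)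
      = c * (a k * (order_stat n X k \<omega> - sample_mean n X \<omega>))" if "k \<in> {1..n}" for k
    using order_stat_scale[where Y = Y and X = X and \<eta> = \<eta> and \<omega> = \<omega>, OF that assms] sample_mean_scale[where Y = Y and X = X and \<eta> = \<eta> and \<omega> = \<omega>, OF assms(2)]
    by (simp add: algebra_simps)
  then show ?thesis unfolding L_stat_def sum_distrib_left by (intro sum.cong refl)
qed

lemma measurable_sample_mean:
  assumes [measurable]: "\<And>i. i \<in> {1..n} \<Longrightarrow> X i \<in> borel_measurable M"
  shows "sample_mean n X \<in> borel_measurable M"
  unfolding sample_mean_def[abs_def] by measurable

lemma measurable_L_stat:
  assumes X: "\<And>i. i \<in> {1..n} \<Longrightarrow> X i \<in> borel_measurable M"
  shows "L_stat n a X \<in> borel_measurable M"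
proof -
  note [measurable] = measurable_sample_mean[of n X M, OF X] measurable_order_stat[of _ n X M, OF _ X]
  show ?thesis unfolding L_stat_def[abs_def] by measurable
qed

section \<open>Polar coordinates on the positive orthant\<close>

(* Rewriting 1 to Suc 0 would take the index sets {1..n} out of the form in which the measurability
   rules mention them. *)
declare One_nat_def [simp del]

abbreviation Leb :: "nat \<Rightarrow> (nat \<Rightarrow> real) measure" where
  "Leb n \<equiv> Pi\<^sub>M {1..n} (\<lambda>_. lborel)"

abbreviation avg :: "nat \<Rightarrow> (nat \<Rightarrow> real) \<Rightarrow> real" where
  "avg n \<equiv> sample_mean n (\<lambda>i y. y i)"

definition scaled :: "nat \<Rightarrow> real \<Rightarrow> (nat \<Rightarrow> real) \<Rightarrow> nat \<Rightarrow> real" where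
  "scaled n r y = (\<lambda>i\<in>{1..n}. r * y i)"

definition orthant :: "nat \<Rightarrow> (nat \<Rightarrow> real) set" where
  "orthant n = {y \<in> space (Leb n). \<forall>i\<in>{1..n}. 0 < y i}"

text \<open>
  The angular part of Lebesgue measure: the cone measure on the simplex of positive vectors of mean
  1. The factor \<open>n\<close> compensates for \<open>\<integral>\<^sub>0\<^sup>1 r\<^sup>n\<^sup>-\<^sup>1 dr = 1/n\<close>, so that the radial density is \<open>r\<^sup>n\<^sup>-\<^sup>1\<close> without a
  constant.
\<close>

definition simplex_measure :: "nat \<Rightarrow> (nat \<Rightarrow> real) measure" where
  "simplex_measure n =
     distr (density (Leb n) (\<lambda>y. ennreal (real n) * indicator {y \<in> orthant n. avg n y \<le> 1} y))
       (Leb n) (\<lambda>y. scaled n (1 / avg n y) y)"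

lemma scaled_apply [simp]: "i \<in> {1..n} \<Longrightarrow> scaled n r y i = r * y i"
  by (simp add: scaled_def)

lemma scaled_scaled: "scaled n r (scaled n s y) = scaled n (r * s) y"
  by (auto simp: scaled_def fun_eq_iff)

lemma scaled_in_space: "scaled n r y \<in> space (Leb n)"
  by (simp add: scaled_def space_PiM)

lemma avg_scaled: "avg n (scaled n r y) = r * avg n y"
  by (rule sample_mean_scale) simp

lemma avg_measurable [measurable]: "avg n \<in> borel_measurable (Leb n)"
  by (rule measurable_sample_mean) measurable

lemma scaled_measurable [measurable]: "(\<lambda>(r, y). scaled n r y) \<in> borel \<Otimes>\<^sub>M Leb n \<rightarrow>\<^sub>M Leb n"
  unfolding scaled_def by measurable

lemma orthant_sets [measurable]: "orthant n \<in> sets (Leb n)"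
  unfolding orthant_def by measurable

lemma avg_pos: "0 < n \<Longrightarrow> y \<in> orthant n \<Longrightarrow> 0 < avg n y"
  by (auto simp: orthant_def sample_mean_def intro!: divide_pos_pos sum_pos)

lemma scaled_in_orthant_iff:
  "0 < r \<Longrightarrow> y \<in> space (Leb n) \<Longrightarrow> scaled n r y \<in> orthant n \<longleftrightarrow> y \<in> orthant n"
  using scaled_in_space by (auto simp: orthant_def zero_less_mult_iff)

interpretation Leb: product_sigma_finite "\<lambda>_::nat. lborel :: real measure"
  by standard

interpretation Leb_fin: finite_product_sigma_finite "\<lambda>_::nat. lborel :: real measure" "{1..n}" for n
  by standard simp

text \<open>
  A product measure is determined by its values on boxes, where scaling is the one-dimensional
  statement.
\<close>

lemma Leb_scale:
  assumes s: "0 < s"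
  shows "Leb n = density (distr (Leb n) (Leb n) (scaled n s)) (\<lambda>_. ennreal (s ^ n))"
proof -
  have [measurable]: "scaled n s \<in> Leb n \<rightarrow>\<^sub>M Leb n"
    unfolding scaled_def by measurable
  have "density (distr (Leb n) (Leb n) (scaled n s)) (\<lambda>_. ennreal (s ^ n)) = Leb n"
  proof (rule Leb.PiM_eqI)
    fix A :: "nat \<Rightarrow> real set" assume A: "\<And>i. i \<in> {1..n} \<Longrightarrow> A i \<in> sets lborel"
    then have box: "Pi\<^sub>E {1..n} A \<in> sets (Leb n)" by (intro sets_PiM_I_finite) auto
    have pre: "(\<lambda>x. s * x) -` A i \<in> sets lborel" if "i \<in> {1..n}" for i
      using A[OF that] measurable_sets[of "\<lambda>x. s * x" borel borel "A i"] by simp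
    have "scaled n s -` Pi\<^sub>E {1..n} A \<inter> space (Leb n) = Pi\<^sub>E {1..n} (\<lambda>i. (\<lambda>x. s * x) -` A i)"
      by (auto simp: scaled_def space_PiM PiE_def Pi_def extensional_def)
    then have "emeasure (density (distr (Leb n) (Leb n) (scaled n s)) (\<lambda>_. ennreal (s ^ n))) (Pi\<^sub>E {1..n} A)
       = ennreal (s ^ n) * emeasure (Leb n) (Pi\<^sub>E {1..n} (\<lambda>i. (\<lambda>x. s * x) -` A i))"
      using box by (simp add: emeasure_density_const emeasure_distr)
    also have "\<dots> = (\<Prod>i\<in>{1..n}. ennreal s) * (\<Prod>i\<in>{1..n}. emeasure lborel ((\<lambda>x. s * x) -` A i))"
      using s pre Leb.emeasure_PiM[of "{1..n}" "\<lambda>i. (\<lambda>x. s * x) -` A i"]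
      by (simp add: ennreal_power)
    also have "\<dots> = (\<Prod>i\<in>{1..n}. ennreal s * emeasure lborel ((\<lambda>x. s * x) -` A i))"
      by (simp add: prod.distrib)
    also have "\<dots> = (\<Prod>i\<in>{1..n}. emeasure lborel (A i))"
    proof (rule prod.cong[OF refl])
      fix i assume i: "i \<in> {1..n}"
      have "emeasure lborel (A i) = (\<integral>\<^sup>+x. indicator (A i) x \<partial>lborel)"
        using A[OF i] by simp
      also have "\<dots> = ennreal \<bar>s\<bar> * (\<integral>\<^sup>+x. indicator (A i) (0 + s * x) \<partial>lborel)"
        using A[OF i] s by (intro nn_integral_real_affine) auto
      also have "(\<integral>\<^sup>+x. indicator (A i) (0 + s * x) \<partial>lborel)
          = (\<integral>\<^sup>+x. indicator ((\<lambda>x. s * x) -` A i) x \<partial>lborel)"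
        by (intro nn_integral_cong) (simp split: split_indicator)
      also have "\<dots> = emeasure lborel ((\<lambda>x. s * x) -` A i)"
        using pre[OF i] by simp
      finally show "ennreal s * emeasure lborel ((\<lambda>x. s * x) -` A i) = emeasure lborel (A i)"
        using s by simp
    qed
    finally show "emeasure (density (distr (Leb n) (Leb n) (scaled n s)) (\<lambda>_. ennreal (s ^ n))) (Pi\<^sub>E {1..n} A)
       = (\<Prod>i\<in>{1..n}. emeasure lborel (A i))" .
  qed auto
  then show ?thesis by simp
qed

lemma nn_integral_Leb_scale:
  assumes s: "0 < s" and [measurable]: "H \<in> borel_measurable (Leb n)"
  shows "(\<integral>\<^sup>+y. H y \<partial>Leb n) = ennreal (s ^ n) * (\<integral>\<^sup>+y. H (scaled n s y) \<partial>Leb n)"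
proof -
  have [measurable]: "scaled n s \<in> Leb n \<rightarrow>\<^sub>M Leb n"
    unfolding scaled_def by measurable
  have "(\<integral>\<^sup>+y. H y \<partial>Leb n) = (\<integral>\<^sup>+y. H y \<partial>density (distr (Leb n) (Leb n) (scaled n s)) (\<lambda>_. ennreal (s ^ n)))"
    using Leb_scale[OF s, of n] by simp
  also have "\<dots> = ennreal (s ^ n) * (\<integral>\<^sup>+y. H (scaled n s y) \<partial>Leb n)"
    by (simp add: nn_integral_density nn_integral_distr nn_integral_cmult)
  finally show ?thesis .
qed

lemma sets_simplex_measure [measurable_cong, simp]: "sets (simplex_measure n) = sets (Leb n)"
  by (simp add: simplex_measure_def)

lemma space_simplex_measure [simp]: "space (simplex_measure n) = space (Leb n)"
  by (simp add: simplex_measure_def)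

lemma normalize_measurable [measurable]: "(\<lambda>y. scaled n (1 / avg n y) y) \<in> Leb n \<rightarrow>\<^sub>M Leb n"
  by measurable

lemma nn_integral_simplex_measure:
  assumes [measurable]: "G \<in> borel_measurable (Leb n)"
  shows "(\<integral>\<^sup>+\<omega>. G \<omega> \<partial>simplex_measure n) =
    (\<integral>\<^sup>+y. ennreal (real n) * indicator {y \<in> orthant n. avg n y \<le> 1} y
       * G (scaled n (1 / avg n y) y) \<partial>Leb n)"
proof -
  have [measurable]: "{y \<in> orthant n. avg n y \<le> 1} \<in> sets (Leb n)"
  proof -
    have "{y \<in> orthant n. avg n y \<le> 1} = orthant n \<inter> {y \<in> space (Leb n). avg n y \<le> 1}"
      by (auto simp: orthant_def)
    also have "\<dots> \<in> sets (Leb n)" by measurable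
    finally show ?thesis .
  qed
  show ?thesis
    unfolding simplex_measure_def
    by (simp add: nn_integral_distr nn_integral_density mult.assoc)
qed

text \<open>
  The weight that appears in the polar coordinate formula after both integrals have been
  interchanged; that it integrates to 1 is what makes the formula hold.
\<close>

lemma nn_integral_power_tail:
  assumes "0 < n" "0 < m"
  shows "(\<integral>\<^sup>+s. ennreal (real n * m ^ n / s ^ (n + 1)) * indicator {m..} s \<partial>lborel) = 1"
proof -
  have "(\<integral>\<^sup>+s. ennreal (real n * m ^ n / s ^ (n + 1)) * indicator {m..} s \<partial>lborel)
      = ennreal (0 - (- ((m / m) ^ n)))"
  proof (rule nn_integral_FTC_atLeast[where F = "\<lambda>s. - ((m / s) ^ n)"])
    show "((\<lambda>s. - ((m / s) ^ n)) has_real_derivative real n * m ^ n / x ^ (n + 1)) (at x)"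
      if "m \<le> x" for x
    proof -
      obtain k where k: "n = Suc k" using assms(1) by (cases n) auto
      have "((\<lambda>s. m / s) has_real_derivative - m / (x * x)) (at x)"
        using that assms by (auto intro!: derivative_eq_intros)
      then have "((\<lambda>s. - ((m / s) ^ n)) has_real_derivative
          - (real n * (- m / (x * x) * (m / x) ^ (n - 1)))) (at x)"
        by (rule DERIV_cong[OF DERIV_minus[OF DERIV_power[where n = n]]]) (simp add: One_nat_def)
      also have "- (real n * (- m / (x * x) * (m / x) ^ (n - 1))) = real n * m ^ n / x ^ (n + 1)"
        using k by (simp add: power_divide power_add)
      finally show ?thesis .
    qed
    show "((\<lambda>s. - ((m / s) ^ n)) \<longlongrightarrow> 0) at_top"
    proof -
      have "((\<lambda>s. - ((m / s) ^ n)) \<longlongrightarrow> - (0 ^ n)) at_top"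
        by (intro tendsto_intros tendsto_divide_0[OF tendsto_const] filterlim_at_top_imp_at_infinity filterlim_ident)
      then show ?thesis using assms by (simp add: power_0_left)
    qed
    show "0 \<le> real n * m ^ n / x ^ (n + 1)" if "m \<le> x" for x
      using that assms by simp
  qed measurable
  then show ?thesis using assms by simp
qed

text \<open>
  Unfolding the cone measure, the right-hand side is an integral over \<open>y\<close> with mean at most 1 and
  over \<open>r\<close> of \<open>H(r y / m)\<close>, where \<open>m\<close> is the mean of \<open>y\<close>. The substitution \<open>r = m s\<close> turns the argument
  of \<open>H\<close> into \<open>s y\<close>, the substitution \<open>z = s y\<close> for fixed \<open>s\<close> turns it into \<open>z\<close>, and the remaining
  integral over \<open>s\<close> is that of \<open>nn_integral_power_tail\<close>. Only Tonelli's theorem and scaling are used,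
  no Jacobian.
\<close>

lemma polar_coordinates:
  assumes n: "0 < n" and H [measurable]: "H \<in> borel_measurable (Leb n)"
    and supp: "\<And>y. y \<notin> orthant n \<Longrightarrow> H y = 0"
  shows "(\<integral>\<^sup>+y. H y \<partial>Leb n) =
    (\<integral>\<^sup>+\<omega>. (\<integral>\<^sup>+r. ennreal (r ^ (n - 1)) * indicator {0<..} r * H (scaled n r \<omega>) \<partial>lborel)
       \<partial>simplex_measure n)"
proof -
  define w where "w = (\<lambda>y. ennreal (real n) * indicator {y \<in> orthant n. avg n y \<le> 1} y)"
  have A: "{y \<in> orthant n. avg n y \<le> 1} = orthant n \<inter> {y \<in> space (Leb n). avg n y \<le> 1}"
    by (auto simp: orthant_def)
  have [measurable]: "w \<in> borel_measurable (Leb n)"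
    unfolding w_def A by measurable
  have [measurable]: "scaled n s \<in> Leb n \<rightarrow>\<^sub>M Leb n" for s
    unfolding scaled_def by measurable
  interpret pair_sigma_finite "Leb n" lborel
    by standard
  define k where "k = (\<lambda>r::real. ennreal (r ^ (n - 1)) * indicator {0<..} r)"
  have [measurable]: "k \<in> borel_measurable borel" unfolding k_def by measurable
  have "(\<integral>\<^sup>+\<omega>. (\<integral>\<^sup>+r. k r * H (scaled n r \<omega>) \<partial>lborel) \<partial>simplex_measure n)
      = (\<integral>\<^sup>+y. w y * (\<integral>\<^sup>+r. k r * H (scaled n (r * (1 / avg n y)) y) \<partial>lborel) \<partial>Leb n)"
    by (subst nn_integral_simplex_measure) (simp_all add: w_def scaled_scaled)
  also have "\<dots> = (\<integral>\<^sup>+y. w y * (\<integral>\<^sup>+s. ennreal (avg n y ^ n) * k s * H (scaled n s y) \<partial>lborel) \<partial>Leb n)"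
  proof (rule nn_integral_cong)
    fix y assume "y \<in> space (Leb n)"
    then have meas: "(\<lambda>r. H (scaled n (r * c) y)) \<in> borel_measurable borel" for c
      by measurable
    show "w y * (\<integral>\<^sup>+r. k r * H (scaled n (r * (1 / avg n y)) y) \<partial>lborel)
        = w y * (\<integral>\<^sup>+s. ennreal (avg n y ^ n) * k s * H (scaled n s y) \<partial>lborel)"
    proof (cases "y \<in> orthant n")
      case True
      note m = avg_pos[OF n True]
      have "(\<integral>\<^sup>+r. k r * H (scaled n (r * (1 / avg n y)) y) \<partial>lborel)
          = ennreal \<bar>avg n y\<bar> * (\<integral>\<^sup>+s. k (0 + avg n y * s) * H (scaled n ((0 + avg n y * s) * (1 / avg n y)) y) \<partial>lborel)"
        using m by (intro nn_integral_real_affine borel_measurable_times_ennreal meas) auto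
      also have "\<dots> = (\<integral>\<^sup>+s. ennreal \<bar>avg n y\<bar> * (k (0 + avg n y * s) * H (scaled n ((0 + avg n y * s) * (1 / avg n y)) y)) \<partial>lborel)"
        using m meas[of 1]
        by (subst nn_integral_cmult) auto
      also have "\<dots> = (\<integral>\<^sup>+s. ennreal (avg n y ^ n) * k s * H (scaled n s y) \<partial>lborel)"
      proof (rule nn_integral_cong)
        fix s
        have "ennreal \<bar>avg n y\<bar> * k (avg n y * s) = ennreal (avg n y ^ n) * k s"
          using m n by (cases n)
            (auto simp: k_def zero_less_mult_iff power_mult_distrib ac_simps simp flip: ennreal_mult split: split_indicator)
        then show "ennreal \<bar>avg n y\<bar> * (k (0 + avg n y * s) * H (scaled n ((0 + avg n y * s) * (1 / avg n y)) y))
          = ennreal (avg n y ^ n) * k s * H (scaled n s y)"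
          using m by (simp add: mult.assoc[symmetric])
      qed
      finally show ?thesis by simp
    qed (simp add: w_def)
  qed
  also have "\<dots> = (\<integral>\<^sup>+y. (\<integral>\<^sup>+s. w y * (ennreal (avg n y ^ n) * k s * H (scaled n s y)) \<partial>lborel) \<partial>Leb n)"
    by (intro nn_integral_cong nn_integral_cmult[symmetric]) measurable
  also have "\<dots> = (\<integral>\<^sup>+s. (\<integral>\<^sup>+y. w y * (ennreal (avg n y ^ n) * k s * H (scaled n s y)) \<partial>Leb n) \<partial>lborel)"
    by (intro Fubini'[symmetric]) measurable
  also have "\<dots> = (\<integral>\<^sup>+s. (\<integral>\<^sup>+z. ennreal (real n * avg n z ^ n / s ^ (n + 1)) * indicator {avg n z..} s * H z \<partial>Leb n) \<partial>lborel)"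
  proof (rule nn_integral_cong)
    fix s :: real
    define K where "K = (\<lambda>z. ennreal (real n * avg n z ^ n / s ^ (n + 1)) * indicator {avg n z..} s * H z)"
    have K_if: "K = (\<lambda>z. ennreal (real n * avg n z ^ n / s ^ (n + 1)) * (if avg n z \<le> s then 1 else 0) * H z)"
      by (auto simp: K_def fun_eq_iff split: split_indicator)
    have [measurable]: "K \<in> borel_measurable (Leb n)"
      unfolding K_if by measurable
    show "(\<integral>\<^sup>+y. w y * (ennreal (avg n y ^ n) * k s * H (scaled n s y)) \<partial>Leb n) = (\<integral>\<^sup>+z. K z \<partial>Leb n)"
    proof (cases "0 < s")
      case True
      have "(\<integral>\<^sup>+z. K z \<partial>Leb n) = (\<integral>\<^sup>+y. ennreal (s ^ n) * K (scaled n s y) \<partial>Leb n)"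
        by (subst nn_integral_Leb_scale[OF True]) (simp_all add: nn_integral_cmult)
      also have "\<dots> = (\<integral>\<^sup>+y. w y * (ennreal (avg n y ^ n) * k s * H (scaled n s y)) \<partial>Leb n)"
      proof (rule nn_integral_cong)
        fix y assume y: "y \<in> space (Leb n)"
        show "ennreal (s ^ n) * K (scaled n s y) = w y * (ennreal (avg n y ^ n) * k s * H (scaled n s y))"
        proof (cases "y \<in> orthant n")
          case orth: True
          note m = avg_pos[OF n orth]
          have "s ^ n * (real n * (s * avg n y) ^ n / s ^ (n + 1)) = real n * (avg n y ^ n * s ^ (n - 1))"
            using True n by (cases n) (simp_all add: power_mult_distrib power_add)
          then have "ennreal (s ^ n) * ennreal (real n * (s * avg n y) ^ n / s ^ (n + 1))
              = ennreal (real n) * (ennreal (avg n y ^ n) * ennreal (s ^ (n - 1)))"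
            using True m by (simp flip: ennreal_mult)
          moreover have "indicator {s * avg n y..} s = (indicator {y \<in> orthant n. avg n y \<le> 1} y :: ennreal)"
            using orth True by (auto split: split_indicator)
          moreover have "ennreal (s ^ n) * K (scaled n s y)
            = (ennreal (s ^ n) * ennreal (real n * (s * avg n y) ^ n / s ^ (n + 1)))
              * indicator {s * avg n y..} s * H (scaled n s y)"
            by (simp add: K_def avg_scaled mult.assoc)
          ultimately show ?thesis
            using True unfolding w_def k_def by (simp add: mult_ac)
        next
          case False
          then show ?thesis
            using supp[of "scaled n s y"] scaled_in_orthant_iff[OF True y] by (simp add: K_def)
        qed
      qed
      finally show ?thesis by simp
    next
      case False
      have "K z = 0" for z
        using supp[of z] avg_pos[OF n, of z] False by (cases "z \<in> orthant n") (auto simp: K_def)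
      then show ?thesis using False by (simp add: k_def)
    qed
  qed
  also have "\<dots> = (\<integral>\<^sup>+z. (\<integral>\<^sup>+s. ennreal (real n * avg n z ^ n / s ^ (n + 1)) * indicator {avg n z..} s * H z \<partial>lborel) \<partial>Leb n)"
    unfolding indicator_def atLeast_iff by (intro Fubini') measurable
  also have "\<dots> = (\<integral>\<^sup>+z. H z \<partial>Leb n)"
  proof (rule nn_integral_cong)
    fix z
    have "(\<integral>\<^sup>+s. ennreal (real n * avg n z ^ n / s ^ (n + 1)) * indicator {avg n z..} s \<partial>lborel) * H z = H z"
      using supp[of z] nn_integral_power_tail[OF n avg_pos[OF n, of z]] by (cases "z \<in> orthant n") auto
    then show "(\<integral>\<^sup>+s. ennreal (real n * avg n z ^ n / s ^ (n + 1)) * indicator {avg n z..} s * H z \<partial>lborel) = H z"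
      by (subst nn_integral_multc) auto
  qed
  finally show ?thesis by (simp add: k_def)
qed

text \<open>
  The positive vectors of mean at most 1 lie in the cube \<open>[0, n]\<^sup>n\<close>.
\<close>

lemma finite_simplex_measure:
  assumes n: "0 < n"
  shows "finite_measure (simplex_measure n)"
proof
  have box: "{y \<in> orthant n. avg n y \<le> 1} \<subseteq> Pi\<^sub>E {1..n} (\<lambda>_. {0..real n})"
  proof
    fix y assume y: "y \<in> {y \<in> orthant n. avg n y \<le> 1}"
    have "y i \<le> real n" if i: "i \<in> {1..n}" for i
    proof -
      have "y i \<le> (\<Sum>i = 1..n. y i)"
        using y i by (intro member_le_sum) (auto simp: orthant_def intro: less_imp_le)
      also have "\<dots> \<le> real n"
        using y n by (auto simp: sample_mean_def divide_simps)
      finally show ?thesis .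
    qed
    then show "y \<in> Pi\<^sub>E {1..n} (\<lambda>_. {0..real n})"
      using y by (auto simp: orthant_def space_PiM PiE_def Pi_def intro: less_imp_le)
  qed
  have "emeasure (simplex_measure n) (space (simplex_measure n)) = (\<integral>\<^sup>+\<omega>. 1 \<partial>simplex_measure n)"
    by simp
  also have "\<dots> = (\<integral>\<^sup>+y. ennreal (real n) * indicator {y \<in> orthant n. avg n y \<le> 1} y * 1 \<partial>Leb n)"
    by (rule nn_integral_simplex_measure) simp
  also have "\<dots> \<le> (\<integral>\<^sup>+y. ennreal (real n) * indicator (Pi\<^sub>E {1..n} (\<lambda>_. {0..real n})) y \<partial>Leb n)"
    using box by (intro nn_integral_mono) (auto split: split_indicator)
  also have "\<dots> = ennreal (real n) * emeasure (Leb n) (Pi\<^sub>E {1..n} (\<lambda>_. {0..real n}))"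
    by (intro nn_integral_cmult_indicator sets_PiM_I_finite) auto
  also have "\<dots> < \<infinity>"
    by (simp add: Leb.emeasure_PiM ennreal_mult_less_top ennreal_power)
  finally show "emeasure (simplex_measure n) (space (simplex_measure n)) \<noteq> \<infinity>" by simp
qed

lemma AE_simplex_measure:
  assumes n: "0 < n"
  shows "AE \<omega> in simplex_measure n. \<omega> \<in> orthant n \<and> avg n \<omega> = 1"
proof (rule AE_I)
  let ?N = "{\<omega> \<in> space (Leb n). \<not> (\<omega> \<in> orthant n \<and> avg n \<omega> = 1)}"
  show "{\<omega> \<in> space (simplex_measure n). \<not> (\<omega> \<in> orthant n \<and> avg n \<omega> = 1)} \<subseteq> ?N" by simp
  show N [measurable]: "?N \<in> sets (simplex_measure n)" by simp
  have "emeasure (simplex_measure n) ?N = (\<integral>\<^sup>+\<omega>. indicator ?N \<omega> \<partial>simplex_measure n)"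
    using N by simp
  also have "\<dots> = (\<integral>\<^sup>+y. ennreal (real n) * indicator {y \<in> orthant n. avg n y \<le> 1} y
       * indicator ?N (scaled n (1 / avg n y) y) \<partial>Leb n)"
    by (rule nn_integral_simplex_measure) simp
  also have "\<dots> = (\<integral>\<^sup>+y. 0 \<partial>Leb n)"
  proof (rule nn_integral_cong)
    fix y assume y: "y \<in> space (Leb n)"
    show "ennreal (real n) * indicator {y \<in> orthant n. avg n y \<le> 1} y
       * indicator ?N (scaled n (1 / avg n y) y) = 0"
    proof (cases "y \<in> orthant n")
      case True
      then show ?thesis
        using avg_pos[OF n True] scaled_in_orthant_iff[of "1 / avg n y" y n] y
        by (simp add: avg_scaled)
    qed simp
  qed
  finally show "emeasure (simplex_measure n) ?N = 0" by simp
qed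

text \<open>
  Directions arbitrarily close to the diagonal have positive measure even if the diagonal itself is
  left out. Excluding it here gives the strict inequality of \<open>integral_exp_log_defect_strict_mono\<close>. The
  witness is a small box next to \<open>(1/2, \<dots>, 1/2)\<close>, in which the first coordinate is separated from the
  others.
\<close>

lemma simplex_measure_near_center:
  assumes n: "2 \<le> n" and "0 < \<delta>"
  shows "emeasure (simplex_measure n)
    {\<omega> \<in> space (Leb n). (\<forall>i\<in>{1..n}. \<bar>\<omega> i - 1\<bar> \<le> \<delta>) \<and> \<omega> 1 \<noteq> \<omega> 2} \<noteq> 0"
proof -
  define \<eta> where "\<eta> = min (1 / 2) (\<delta> / 2)"
  have \<eta>: "0 < \<eta>" "\<eta> \<le> 1 / 2" "2 * \<eta> \<le> \<delta>"
    using assms by (auto simp: \<eta>_def)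
  let ?S = "{\<omega> \<in> space (Leb n). (\<forall>i\<in>{1..n}. \<bar>\<omega> i - 1\<bar> \<le> \<delta>) \<and> \<omega> 1 \<noteq> \<omega> 2}"
  define J where "J = (\<lambda>i::nat. if i = 1 then {1 / 2 + \<eta> / 2..1 / 2 + \<eta>} else {1 / 2..1 / 2 + \<eta> / 4})"
  have [simp]: "J i \<in> sets borel" for i by (simp add: J_def)
  have S [measurable]: "?S \<in> sets (Leb n)"
  proof -
    have "1 \<in> {1..n}" "2 \<in> {1..n}" using n by auto
    then have "(\<lambda>\<omega>. \<omega> 1) \<in> borel_measurable (Leb n)" "(\<lambda>\<omega>. \<omega> 2) \<in> borel_measurable (Leb n)"
      by measurable
    then have "{\<omega> \<in> space (Leb n). \<omega> 1 \<noteq> \<omega> 2} \<in> sets (Leb n)"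
      by (rule borel_measurable_neq)
    moreover have "{\<omega> \<in> space (Leb n). \<forall>i\<in>{1..n}. \<bar>\<omega> i - 1\<bar> \<le> \<delta>} \<in> sets (Leb n)"
      by measurable
    moreover have "?S = {\<omega> \<in> space (Leb n). \<forall>i\<in>{1..n}. \<bar>\<omega> i - 1\<bar> \<le> \<delta>} \<inter> {\<omega> \<in> space (Leb n). \<omega> 1 \<noteq> \<omega> 2}"
      by auto
    ultimately show ?thesis by (simp only: sets.Int)
  qed
  have "0 < (\<Prod>i\<in>{1..n}. emeasure lborel (J i))"
    using \<eta> by (simp add: less_le prod_zero_iff J_def)
  also have "\<dots> = (\<integral>\<^sup>+y. indicator (Pi\<^sub>E {1..n} J) y \<partial>Leb n)"
    by (subst nn_integral_indicator) (auto simp: Leb.emeasure_PiM intro!: sets_PiM_I_finite)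
  also have "\<dots> \<le> (\<integral>\<^sup>+y. ennreal (real n) * indicator {y \<in> orthant n. avg n y \<le> 1} y
       * indicator ?S (scaled n (1 / avg n y) y) \<partial>Leb n)"
  proof (rule nn_integral_mono)
    fix y
    show "indicator (Pi\<^sub>E {1..n} J) y \<le> ennreal (real n) * indicator {y \<in> orthant n. avg n y \<le> 1} y
       * indicator ?S (scaled n (1 / avg n y) y)"
    proof (cases "y \<in> Pi\<^sub>E {1..n} J")
      case True
      then have y: "y i \<in> J i" if "i \<in> {1..n}" for i
        using that by auto
      have b: "1 / 2 \<le> y i" "y i \<le> 1 / 2 + \<eta>" if "i \<in> {1..n}" for i
        using y[OF that] \<eta> by (auto simp: J_def split: if_splits)
      have m: "1 / 2 \<le> avg n y" "avg n y \<le> 1 / 2 + \<eta>"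
        using sample_mean_between[of n "1 / 2" "\<lambda>i y. y i" y "1 / 2 + \<eta>", OF _ b] n by simp_all
      have "\<bar>y i / avg n y - 1\<bar> \<le> \<delta>" if i: "i \<in> {1..n}" for i
      proof -
        have "\<bar>y i - avg n y\<bar> \<le> \<eta>" using b[OF i] m by auto
        also have "\<dots> \<le> \<delta> * (1 / 2)" using \<eta> by simp
        also have "\<dots> \<le> \<delta> * avg n y" using m assms(2) by (intro mult_left_mono) auto
        finally have "\<bar>y i - avg n y\<bar> / avg n y \<le> \<delta>"
          using m by (simp add: divide_simps)
        also have "\<bar>y i - avg n y\<bar> / avg n y = \<bar>y i / avg n y - 1\<bar>"
          using m by (simp add: abs_if divide_simps)
        finally show ?thesis .
      qed
      moreover have "y 1 \<noteq> y 2"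
        using y[of 1] y[of 2] n \<eta> by (auto simp: J_def)
      moreover have "y \<in> orthant n"
      proof -
        have "0 < y i" if "i \<in> {1..n}" for i using b(1)[OF that] by simp
        then show ?thesis
          using True by (auto simp: orthant_def space_PiM PiE_def)
      qed
      moreover have "1 \<le> ennreal (real n)"
        using n by (simp flip: ennreal_1 add: ennreal_leI)
      moreover have "1 \<in> {1..n}" "2 \<in> {1..n}" "avg n y \<noteq> 0" "avg n y \<le> 1"
        using n m \<eta> by auto
      ultimately show ?thesis
        using scaled_in_space by (auto split: split_indicator)
    qed simp
  qed
  also have "\<dots> = (\<integral>\<^sup>+\<omega>. indicator ?S \<omega> \<partial>simplex_measure n)"
    by (rule nn_integral_simplex_measure[symmetric]) simp
  also have "\<dots> = emeasure (simplex_measure n) ?S"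
    using S by simp
  finally show ?thesis by simp
qed

section \<open>The joint law of the mean and a scale-invariant statistic\<close>

lemma PiM_density_Leb:
  assumes [measurable]: "f \<in> borel_measurable borel" and "prob_space (density lborel f)"
  shows "Pi\<^sub>M {1..n} (\<lambda>_. density lborel f) = density (Leb n) (\<lambda>y. \<Prod>i\<in>{1..n}. f (y i))"
proof -
  interpret prob_space "density lborel f" by fact
  interpret D: product_sigma_finite "\<lambda>_::nat. density lborel f"
    by standard
  show ?thesis
  proof (rule D.PiM_eqI[symmetric])
    show "sets (density (Leb n) (\<lambda>y. \<Prod>i\<in>{1..n}. f (y i))) = sets (Pi\<^sub>M {1..n} (\<lambda>_. density lborel f))"
      by (simp cong: sets_PiM_cong)
    fix A :: "nat \<Rightarrow> real set" assume "\<And>i. i \<in> {1..n} \<Longrightarrow> A i \<in> sets (density lborel f)"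
    then have A: "\<And>i. i \<in> {1..n} \<Longrightarrow> A i \<in> sets borel" by simp
    have "emeasure (density (Leb n) (\<lambda>y. \<Prod>i\<in>{1..n}. f (y i))) (Pi\<^sub>E {1..n} A)
        = (\<integral>\<^sup>+y. (\<Prod>i\<in>{1..n}. f (y i)) * indicator (Pi\<^sub>E {1..n} A) y \<partial>Leb n)"
      using A by (intro emeasure_density sets_PiM_I_finite) (auto simp del: measurable_lborel1)
    also have "\<dots> = (\<integral>\<^sup>+y. (\<Prod>i\<in>{1..n}. f (y i) * indicator (A i) (y i)) \<partial>Leb n)"
      by (intro nn_integral_cong)
         (auto simp: prod.distrib prod_zero_iff space_PiM PiE_def Pi_def split: split_indicator)
    also have "\<dots> = (\<Prod>i\<in>{1..n}. \<integral>\<^sup>+x. f x * indicator (A i) x \<partial>lborel)"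
      using A by (intro Leb.product_nn_integral_prod) auto
    also have "\<dots> = (\<Prod>i\<in>{1..n}. emeasure (density lborel f) (A i))"
      using A by (intro prod.cong refl emeasure_density[symmetric]) auto
    finally show "emeasure (density (Leb n) (\<lambda>y. \<Prod>i\<in>{1..n}. f (y i))) (Pi\<^sub>E {1..n} A)
        = (\<Prod>i\<in>{1..n}. emeasure (density lborel f) (A i))" .
  qed simp
qed

lemma (in prob_space) indep_var_iff_emeasure:
  fixes U V :: "'a \<Rightarrow> real"
  assumes [measurable]: "random_variable borel U" "random_variable borel V"
  shows "indep_var borel U borel V \<longleftrightarrow> (\<forall>B\<in>sets borel. \<forall>D\<in>sets borel.
     emeasure M {\<omega> \<in> space M. U \<omega> \<in> B \<and> V \<omega> \<in> D}
       = emeasure M {\<omega> \<in> space M. U \<omega> \<in> B} * emeasure M {\<omega> \<in> space M. V \<omega> \<in> D})"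
proof -
  let ?J = "distr M (borel \<Otimes>\<^sub>M borel) (\<lambda>x. (U x, V x))"
  have U: "emeasure (distr M borel U) B = emeasure M {\<omega> \<in> space M. U \<omega> \<in> B}" if "B \<in> sets borel" for B
    using that by (simp add: emeasure_distr vimage_def Int_def conj_commute)
  have V: "emeasure (distr M borel V) B = emeasure M {\<omega> \<in> space M. V \<omega> \<in> B}" if "B \<in> sets borel" for B
    using that by (simp add: emeasure_distr vimage_def Int_def conj_commute)
  have J: "emeasure ?J (B \<times> D) = emeasure M {\<omega> \<in> space M. U \<omega> \<in> B \<and> V \<omega> \<in> D}"
    if "B \<in> sets borel" "D \<in> sets borel" for B D
    using that by (simp add: emeasure_distr vimage_def Int_def conj_commute)
  interpret U: prob_space "distr M borel U" by (rule prob_space_distr) simp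
  interpret V: prob_space "distr M borel V" by (rule prob_space_distr) simp
  show ?thesis
    unfolding indep_var_distribution_eq
  proof safe
    fix B D :: "real set" assume *: "distr M borel U \<Otimes>\<^sub>M distr M borel V = ?J" "B \<in> sets borel" "D \<in> sets borel"
    then have "emeasure ?J (B \<times> D) = emeasure (distr M borel U) B * emeasure (distr M borel V) D"
      by (subst *(1)[symmetric], subst V.emeasure_pair_measure_Times) auto
    then show "emeasure M {\<omega> \<in> space M. U \<omega> \<in> B \<and> V \<omega> \<in> D}
       = emeasure M {\<omega> \<in> space M. U \<omega> \<in> B} * emeasure M {\<omega> \<in> space M. V \<omega> \<in> D}"
      using * U V J by simp
  next
    assume *: "\<forall>B\<in>sets borel. \<forall>D\<in>sets borel.
     emeasure M {\<omega> \<in> space M. U \<omega> \<in> B \<and> V \<omega> \<in> D}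
       = emeasure M {\<omega> \<in> space M. U \<omega> \<in> B} * emeasure M {\<omega> \<in> space M. V \<omega> \<in> D}"
    show "distr M borel U \<Otimes>\<^sub>M distr M borel V = ?J"
      using * U V J
      by (intro pair_measure_eqI U.sigma_finite_measure_axioms V.sigma_finite_measure_axioms)
         (auto cong: sets_pair_measure_cong)
  qed simp_all
qed

text \<open>
  A scale-invariant statistic depends on the direction only, so in polar coordinates the joint event
  is a product set.
\<close>

lemma joint_law:
  fixes X :: "nat \<Rightarrow> 'a \<Rightarrow> real" and f :: "real \<Rightarrow> real" and T :: "(nat \<Rightarrow> real) \<Rightarrow> real"
  assumes M: "prob_space M" and n: "0 < n"
    and indep: "prob_space.indep_vars M (\<lambda>_. borel) X {1..n}"
    and law: "\<And>i. i \<in> {1..n} \<Longrightarrow> distr M borel (X i) = density lborel (\<lambda>x. ennreal (f x))"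
    and f [measurable]: "f \<in> borel_measurable borel" and f0: "\<And>x. x \<le> 0 \<Longrightarrow> f x = 0"
    and T [measurable]: "T \<in> borel_measurable (Leb n)"
    and T_scaled: "\<And>r y. 0 < r \<Longrightarrow> T (scaled n r y) = T y"
    and B [measurable]: "B \<in> sets borel" and D [measurable]: "D \<in> sets borel"
  shows "emeasure M {\<xi> \<in> space M. sample_mean n X \<xi> \<in> B \<and> T (\<lambda>i\<in>{1..n}. X i \<xi>) \<in> D}
    = (\<integral>\<^sup>+r. indicator B r * (ennreal (r ^ (n - 1)) * indicator {0<..} r *
        (\<integral>\<^sup>+\<omega>. indicator D (T \<omega>) * (\<Prod>i\<in>{1..n}. ennreal (f (r * \<omega> i))) \<partial>simplex_measure n)) \<partial>lborel)"
proof -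
  interpret prob_space M by fact
  have X [measurable]: "X i \<in> borel_measurable M" if "i \<in> {1..n}" for i
    using indep that by (auto simp: indep_vars_def)
  interpret S: finite_measure "simplex_measure n" by (rule finite_simplex_measure[OF n])
  interpret pair_sigma_finite "simplex_measure n" lborel by standard
  have prob: "prob_space (density lborel (\<lambda>x. ennreal (f x)))"
    using prob_space_distr[of "X 1" borel] X[of 1] law[of 1] n by auto
  have "distr M (Pi\<^sub>M {1..n} (\<lambda>_. borel)) (\<lambda>\<xi>. \<lambda>i\<in>{1..n}. X i \<xi>) = Pi\<^sub>M {1..n} (\<lambda>i. distr M borel (X i))"
    using indep X n by (subst (asm) indep_vars_iff_distr_eq_PiM') auto
  also have "\<dots> = Pi\<^sub>M {1..n} (\<lambda>_. density lborel (\<lambda>x. ennreal (f x)))"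
    using law by (intro PiM_cong) auto
  also have "\<dots> = density (Leb n) (\<lambda>y. \<Prod>i\<in>{1..n}. ennreal (f (y i)))"
    by (intro PiM_density_Leb prob) simp
  finally have sample: "distr M (Pi\<^sub>M {1..n} (\<lambda>_. borel)) (\<lambda>\<xi>. \<lambda>i\<in>{1..n}. X i \<xi>)
    = density (Leb n) (\<lambda>y. \<Prod>i\<in>{1..n}. ennreal (f (y i)))" .
  have mean: "avg n (\<lambda>i\<in>{1..n}. X i \<xi>) = sample_mean n X \<xi>" for \<xi>
    by (simp add: sample_mean_def)
  define E where "E = {y \<in> space (Leb n). avg n y \<in> B \<and> T y \<in> D}"
  have E [measurable]: "E \<in> sets (Leb n)" unfolding E_def by measurable
  then have E': "E \<in> sets (Pi\<^sub>M {1..n} (\<lambda>_. borel :: real measure))"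
    by (simp cong: sets_PiM_cong)
  define H where "H = (\<lambda>y. (\<Prod>i\<in>{1..n}. ennreal (f (y i))) * indicator E y)"
  have [measurable]: "H \<in> borel_measurable (Leb n)" unfolding H_def by measurable
  have "(\<lambda>\<xi>. \<lambda>i\<in>{1..n}. X i \<xi>) -` E \<inter> space M
      = {\<xi> \<in> space M. sample_mean n X \<xi> \<in> B \<and> T (\<lambda>i\<in>{1..n}. X i \<xi>) \<in> D}"
    by (auto simp: E_def mean space_PiM)
  then have "emeasure M {\<xi> \<in> space M. sample_mean n X \<xi> \<in> B \<and> T (\<lambda>i\<in>{1..n}. X i \<xi>) \<in> D}
      = emeasure (distr M (Pi\<^sub>M {1..n} (\<lambda>_. borel)) (\<lambda>\<xi>. \<lambda>i\<in>{1..n}. X i \<xi>)) E"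
    using E' by (subst emeasure_distr) auto
  also have "\<dots> = (\<integral>\<^sup>+y. H y \<partial>Leb n)"
    unfolding sample H_def by (intro emeasure_density) simp_all
  also have "\<dots> = (\<integral>\<^sup>+\<omega>. (\<integral>\<^sup>+r. ennreal (r ^ (n - 1)) * indicator {0<..} r * H (scaled n r \<omega>) \<partial>lborel)
       \<partial>simplex_measure n)"
  proof (rule polar_coordinates[OF n])
    fix y assume "y \<notin> orthant n"
    show "H y = 0"
    proof (cases "y \<in> space (Leb n)")
      case True
      then obtain i where "i \<in> {1..n}" "y i \<le> 0"
        using \<open>y \<notin> orthant n\<close> by (auto simp: orthant_def not_less)
      then have "(\<Prod>i\<in>{1..n}. ennreal (f (y i))) = 0"
        using f0[of "y i"] by (intro prod_zero bexI[of _ i]) auto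
      then show ?thesis unfolding H_def by simp
    qed (simp add: H_def E_def)
  qed simp
  also have "\<dots> = (\<integral>\<^sup>+\<omega>. (\<integral>\<^sup>+r. indicator B r * (ennreal (r ^ (n - 1)) * indicator {0<..} r *
        (indicator D (T \<omega>) * (\<Prod>i\<in>{1..n}. ennreal (f (r * \<omega> i))))) \<partial>lborel) \<partial>simplex_measure n)"
  proof (rule nn_integral_cong_AE)
    show "AE \<omega> in simplex_measure n.
      (\<integral>\<^sup>+r. ennreal (r ^ (n - 1)) * indicator {0<..} r * H (scaled n r \<omega>) \<partial>lborel)
      = (\<integral>\<^sup>+r. indicator B r * (ennreal (r ^ (n - 1)) * indicator {0<..} r *
        (indicator D (T \<omega>) * (\<Prod>i\<in>{1..n}. ennreal (f (r * \<omega> i))))) \<partial>lborel)"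
      using AE_simplex_measure[OF n]
    proof eventually_elim
      case (elim \<omega>)
      show ?case
      proof (rule nn_integral_cong)
        fix r :: real
        show "ennreal (r ^ (n - 1)) * indicator {0<..} r * H (scaled n r \<omega>)
          = indicator B r * (ennreal (r ^ (n - 1)) * indicator {0<..} r *
            (indicator D (T \<omega>) * (\<Prod>i\<in>{1..n}. ennreal (f (r * \<omega> i)))))"
          using elim scaled_in_space[of n r \<omega>]
          by (cases "0 < r") (auto simp: H_def E_def avg_scaled T_scaled mult_ac split: split_indicator)
      qed
    qed
  qed
  also have "\<dots> = (\<integral>\<^sup>+r. (\<integral>\<^sup>+\<omega>. indicator B r * (ennreal (r ^ (n - 1)) * indicator {0<..} r *
        (indicator D (T \<omega>) * (\<Prod>i\<in>{1..n}. ennreal (f (r * \<omega> i))))) \<partial>simplex_measure n) \<partial>lborel)"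
    by (intro Fubini'[symmetric]) measurable
  also have "\<dots> = (\<integral>\<^sup>+r. indicator B r * (ennreal (r ^ (n - 1)) * indicator {0<..} r *
        (\<integral>\<^sup>+\<omega>. indicator D (T \<omega>) * (\<Prod>i\<in>{1..n}. ennreal (f (r * \<omega> i))) \<partial>simplex_measure n)) \<partial>lborel)"
  proof (rule nn_integral_cong)
    fix r :: real
    have "(\<lambda>\<omega>. indicator D (T \<omega>) * (\<Prod>i\<in>{1..n}. ennreal (f (r * \<omega> i)))) \<in> borel_measurable (simplex_measure n)"
      by measurable
    then show "(\<integral>\<^sup>+\<omega>. indicator B r * (ennreal (r ^ (n - 1)) * indicator {0<..} r *
        (indicator D (T \<omega>) * (\<Prod>i\<in>{1..n}. ennreal (f (r * \<omega> i))))) \<partial>simplex_measure n)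
      = indicator B r * (ennreal (r ^ (n - 1)) * indicator {0<..} r *
        (\<integral>\<^sup>+\<omega>. indicator D (T \<omega>) * (\<Prod>i\<in>{1..n}. ennreal (f (r * \<omega> i))) \<partial>simplex_measure n))"
      by (simp add: nn_integral_cmult)
  qed
  finally show ?thesis .
qed

text \<open>
  If the joint density is \<open>u(r) v(\<omega>)\<close>, the joint law is a product up to the constants \<open>U\<close> and \<open>V\<close> of
  the whole line, and \<open>U V = 1\<close> because all laws are probabilities.
\<close>

lemma indep_if_density_factors:
  fixes X :: "nat \<Rightarrow> 'a \<Rightarrow> real" and f :: "real \<Rightarrow> real" and T :: "(nat \<Rightarrow> real) \<Rightarrow> real"
  assumes M: "prob_space M" and n: "0 < n"
    and indep: "prob_space.indep_vars M (\<lambda>_. borel) X {1..n}"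
    and law: "\<And>i. i \<in> {1..n} \<Longrightarrow> distr M borel (X i) = density lborel (\<lambda>x. ennreal (f x))"
    and f [measurable]: "f \<in> borel_measurable borel" and f0: "\<And>x. x \<le> 0 \<Longrightarrow> f x = 0"
    and T [measurable]: "T \<in> borel_measurable (Leb n)"
    and T_scaled: "\<And>r y. 0 < r \<Longrightarrow> T (scaled n r y) = T y"
    and factor: "\<And>r \<omega>. 0 < r \<Longrightarrow> \<omega> \<in> orthant n \<Longrightarrow> avg n \<omega> = 1 \<Longrightarrow>
       (\<Prod>i\<in>{1..n}. ennreal (f (r * \<omega> i))) = u r * v \<omega>"
    and [measurable]: "u \<in> borel_measurable borel" "v \<in> borel_measurable (Leb n)"
  shows "prob_space.indep_var M borel (sample_mean n X) borel (\<lambda>\<xi>. T (\<lambda>i\<in>{1..n}. X i \<xi>))"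
proof -
  interpret prob_space M by fact
  have X [measurable]: "X i \<in> borel_measurable M" if "i \<in> {1..n}" for i
    using indep that by (auto simp: indep_vars_def)
  have [measurable]: "sample_mean n X \<in> borel_measurable M"
    by (rule measurable_sample_mean) measurable
  let ?TX = "\<lambda>\<xi>. T (\<lambda>i\<in>{1..n}. X i \<xi>)"
  have "(\<lambda>\<xi>. \<lambda>i\<in>{1..n}. X i \<xi>) \<in> M \<rightarrow>\<^sub>M Leb n" by measurable
  then have [measurable]: "?TX \<in> borel_measurable M"
    using T by (rule measurable_compose)
  define U where "U = (\<lambda>B. \<integral>\<^sup>+r. indicator B r * (ennreal (r ^ (n - 1)) * indicator {0<..} r * u r) \<partial>lborel)"
  define V where "V = (\<lambda>D. \<integral>\<^sup>+\<omega>. indicator D (T \<omega>) * v \<omega> \<partial>simplex_measure n)"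
  have prod: "emeasure M {\<xi> \<in> space M. sample_mean n X \<xi> \<in> B \<and> ?TX \<xi> \<in> D} = U B * V D"
    if [measurable]: "B \<in> sets borel" "D \<in> sets borel" for B D
  proof -
    have "emeasure M {\<xi> \<in> space M. sample_mean n X \<xi> \<in> B \<and> ?TX \<xi> \<in> D}
      = (\<integral>\<^sup>+r. indicator B r * (ennreal (r ^ (n - 1)) * indicator {0<..} r *
        (\<integral>\<^sup>+\<omega>. indicator D (T \<omega>) * (\<Prod>i\<in>{1..n}. ennreal (f (r * \<omega> i))) \<partial>simplex_measure n)) \<partial>lborel)"
      by (rule joint_law[OF M n indep law f f0 T T_scaled that])
    also have "\<dots> = (\<integral>\<^sup>+r. indicator B r * (ennreal (r ^ (n - 1)) * indicator {0<..} r * u r) * V D \<partial>lborel)"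
    proof (rule nn_integral_cong)
      fix r :: real
      have "(\<integral>\<^sup>+\<omega>. indicator D (T \<omega>) * (\<Prod>i\<in>{1..n}. ennreal (f (r * \<omega> i))) \<partial>simplex_measure n)
        = (\<integral>\<^sup>+\<omega>. u r * (indicator D (T \<omega>) * v \<omega>) \<partial>simplex_measure n)" if "0 < r"
      proof (rule nn_integral_cong_AE)
        show "AE \<omega> in simplex_measure n. indicator D (T \<omega>) * (\<Prod>i\<in>{1..n}. ennreal (f (r * \<omega> i)))
            = u r * (indicator D (T \<omega>) * v \<omega>)"
          using AE_simplex_measure[OF n]
        proof eventually_elim
          case (elim \<omega>)
          then show ?case using factor[OF that, of \<omega>] by (simp add: mult_ac)
        qed
      qed
      also have "\<dots> = u r * V D"
        unfolding V_def by (rule nn_integral_cmult) measurable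
      finally show "indicator B r * (ennreal (r ^ (n - 1)) * indicator {0<..} r *
        (\<integral>\<^sup>+\<omega>. indicator D (T \<omega>) * (\<Prod>i\<in>{1..n}. ennreal (f (r * \<omega> i))) \<partial>simplex_measure n))
        = indicator B r * (ennreal (r ^ (n - 1)) * indicator {0<..} r * u r) * V D"
        by (cases "0 < r") (auto simp: mult_ac)
    qed
    also have "\<dots> = U B * V D"
      unfolding U_def by (rule nn_integral_multc) measurable
    finally show ?thesis .
  qed
  have UB: "emeasure M {\<xi> \<in> space M. sample_mean n X \<xi> \<in> B} = U B * V UNIV" if "B \<in> sets borel" for B
    using prod[OF that, of UNIV] by simp
  have VD: "emeasure M {\<xi> \<in> space M. ?TX \<xi> \<in> D} = U UNIV * V D" if "D \<in> sets borel" for D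
    using prod[OF _ that, of UNIV] by simp
  have one: "U UNIV * V UNIV = 1"
    using prod[of UNIV UNIV] emeasure_space_1 by simp
  show ?thesis
  proof (subst indep_var_iff_emeasure, goal_cases)
    case 3
    show ?case
    proof (intro ballI)
      fix B D :: "real set" assume BD: "B \<in> sets borel" "D \<in> sets borel"
      have "U B * V UNIV * (U UNIV * V D) = U B * V D * (U UNIV * V UNIV)"
        by (simp only: mult_ac)
      then show "emeasure M {\<xi> \<in> space M. sample_mean n X \<xi> \<in> B \<and> ?TX \<xi> \<in> D}
       = emeasure M {\<xi> \<in> space M. sample_mean n X \<xi> \<in> B} * emeasure M {\<xi> \<in> space M. ?TX \<xi> \<in> D}"
        using BD by (simp add: prod UB VD one)
    qed
  qed simp_all
qed

section \<open>Gamma densities factor in polar coordinates\<close>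

lemma gamma_density_measurable [measurable]: "gamma_density c b \<in> borel_measurable borel"
  unfolding gamma_density_def by measurable

text \<open>
  The exponential factors combine to a function of \<open>r\<close> alone because the coordinates of \<open>\<omega>\<close> sum to
  \<open>n\<close>.
\<close>

lemma prod_gamma_density:
  assumes r: "0 < r" and \<omega>: "\<omega> \<in> orthant n" "avg n \<omega> = 1" and n: "0 < n"
    and cb: "0 < c" "0 < b"
  shows "(\<Prod>i\<in>{1..n}. ennreal (gamma_density c b (r * \<omega> i))) =
    ennreal ((1 / (Gamma c * b powr c) * r powr (c - 1)) ^ n * exp (- real n * r / b))
      * ennreal (\<Prod>i\<in>{1..n}. \<omega> i powr (c - 1))"
proof -
  have pos: "0 < \<omega> i" if "i \<in> {1..n}" for i
    using \<omega> that by (auto simp: orthant_def)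
  have sum: "(\<Sum>i = 1..n. \<omega> i) = real n"
    using \<omega>(2) n by (simp add: sample_mean_def)
  have "(\<Prod>i\<in>{1..n}. ennreal (gamma_density c b (r * \<omega> i))) = ennreal (\<Prod>i\<in>{1..n}. gamma_density c b (r * \<omega> i))"
    using cb by (intro prod_ennreal) (simp add: gamma_density_def Gamma_real_nonneg)
  also have "(\<Prod>i\<in>{1..n}. gamma_density c b (r * \<omega> i))
     = (\<Prod>i\<in>{1..n}. (1 / (Gamma c * b powr c) * r powr (c - 1)) * exp (- r / b * \<omega> i) * \<omega> i powr (c - 1))"
    using r pos cb by (intro prod.cong refl) (simp add: gamma_density_def powr_mult less_imp_le)
  also have "\<dots> = (1 / (Gamma c * b powr c) * r powr (c - 1)) ^ n * exp (- real n * r / b) * (\<Prod>i\<in>{1..n}. \<omega> i powr (c - 1))"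
  proof -
    have "(\<Prod>i = 1..n. exp (- r / b * \<omega> i)) = exp (- r / b * (\<Sum>i = 1..n. \<omega> i))"
      by (simp only: exp_sum[OF finite_atLeastAtMost] sum_distrib_left)
    also have "\<dots> = exp (- real n * r / b)"
      by (simp add: sum mult.commute)
    finally show ?thesis
      by (simp only: prod.distrib prod_constant card_atLeastAtMost) (simp add: power_mult_distrib power_divide)
  qed
  also have "ennreal \<dots> = ennreal ((1 / (Gamma c * b powr c) * r powr (c - 1)) ^ n * exp (- real n * r / b))
      * ennreal (\<Prod>i\<in>{1..n}. \<omega> i powr (c - 1))"
    using cb by (intro ennreal_mult mult_nonneg_nonneg prod_nonneg zero_le_power) (auto simp: Gamma_real_nonneg)
  finally show ?thesis .
qed

section \<open>Log-densities of gamma type and touching\<close>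

text \<open>
  The logarithm of a multiple of \<open>z\<^sup>-\<^sup>A exp(p z)\<close>.
\<close>

definition gamma_log :: "real \<Rightarrow> real \<Rightarrow> real \<Rightarrow> real \<Rightarrow> real" where
  "gamma_log A p q z = p * z + q - A * ln z"

text \<open>
  As for viscosity solutions, a merely continuous function is tested by smooth comparison functions
  that touch it locally from one side. The second-order information is the parameter \<open>A\<close>, since the
  comparison function has second derivative \<open>A / z\<^sup>2\<close>.
\<close>

definition touches_above :: "(real \<Rightarrow> real) \<Rightarrow> real \<Rightarrow> real \<Rightarrow> bool" where
  "touches_above \<phi> A m \<longleftrightarrow> (\<exists>p q l u. 0 < l \<and> l < m \<and> m < u \<and> \<phi> m = gamma_log A p q m \<and>
     (\<forall>z\<in>{l<..<u}. \<phi> z \<le> gamma_log A p q z))"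

definition touches_below :: "(real \<Rightarrow> real) \<Rightarrow> real \<Rightarrow> real \<Rightarrow> bool" where
  "touches_below \<phi> A m \<longleftrightarrow> (\<exists>p q l u. 0 < l \<and> l < m \<and> m < u \<and> \<phi> m = gamma_log A p q m \<and>
     (\<forall>z\<in>{l<..<u}. gamma_log A p q z \<le> \<phi> z))"

text \<open>
  The form used for solving for \<open>A\<close> in the interpolation: \<open>ln\<close>, \<open>1\<close> and the identity form a
  Chebyshev system on the positive axis.
\<close>

lemma ln_strictly_concave:
  fixes x y z :: real
  assumes "0 < x" "x < y" "y < z"
  shows "(z - y) * ln x + (y - x) * ln z < (z - x) * ln y"
proof -
  have strict: "ln t < t - 1" if "0 < t" "t \<noteq> 1" for t :: real
    using ln_le_minus_one[of t] ln_eq_minus_one[of t] that by linarith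
  have "(z - y) * ln (x / y) < (z - y) * (x / y - 1)" "(y - x) * ln (z / y) < (y - x) * (z / y - 1)"
    using assms by (auto intro!: strict mult_strict_left_mono)
  moreover have "(z - y) * (x / y - 1) + (y - x) * (z / y - 1) = 0"
    using assms by (simp add: field_simps)
  moreover have "ln (x / y) = ln x - ln y" "ln (z / y) = ln z - ln y"
    using assms by (auto simp: ln_div)
  ultimately have "(z - y) * (ln x - ln y) + (y - x) * (ln z - ln y) < 0" by simp
  then show ?thesis by (simp add: algebra_simps)
qed

text \<open>
  The second-order difference \<open>D\<close> annihilates affine functions, so \<open>A\<close> must be chosen such that \<open>D\<close>
  annihilates \<open>\<phi> + A ln\<close>; then \<open>p\<close> and \<open>q\<close> are read off from the chord.
\<close>

lemma gamma_log_interpolation: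
  assumes "0 < x" "x < y" "y < z"
  obtains A p q where "\<phi> x = gamma_log A p q x" "\<phi> y = gamma_log A p q y" "\<phi> z = gamma_log A p q z"
proof -
  define D where "D = (\<lambda>g :: real \<Rightarrow> real. (z - x) * g y - (z - y) * g x - (y - x) * g z)"
  define A where "A = - D \<phi> / D ln"
  define g where "g = (\<lambda>t. \<phi> t + A * ln t)"
  define p where "p = (g z - g x) / (z - x)"
  define q where "q = g x - p * x"
  have "D ln > 0" using ln_strictly_concave[OF assms] by (simp add: D_def)
  then have "D \<phi> + A * D ln = 0" by (simp add: A_def)
  then have "D g = 0" by (simp add: D_def g_def algebra_simps)
  have zx: "p * (z - x) = g z - g x" using assms by (simp add: p_def)
  then have "g z = p * z + q" by (simp add: q_def algebra_simps)
  moreover have "g x = p * x + q" by (simp add: q_def)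
  moreover have "g y = p * y + q"
  proof -
    have "(z - x) * g y = (z - y) * (p * x + q) + (y - x) * (p * z + q)"
      using \<open>D g = 0\<close> calculation by (simp add: D_def)
    also have "\<dots> = (z - x) * (p * y + q)" by (simp add: algebra_simps)
    finally show ?thesis using assms by simp
  qed
  ultimately show thesis
    by (intro that[of A p q]) (simp_all add: gamma_log_def g_def)
qed

lemma continuous_gamma_log: "continuous_on {0<..} (gamma_log A p q)"
  unfolding gamma_log_def by (intro continuous_intros) auto

text \<open>
  The difference of \<open>\<phi>\<close> and its interpolant has a maximum on the interval. If it is attained at an
  endpoint, its value is 0, which is also the value at \<open>y\<close>; so there is an interior maximum in any case.
  Raising the interpolant by the maximum value makes it touch.
\<close>

lemma interpolant_touches_above:
  assumes "0 < x" "x < y" "y < z" "continuous_on {0<..} \<phi>"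
    and eq: "\<phi> x = gamma_log A p q x" "\<phi> y = gamma_log A p q y" "\<phi> z = gamma_log A p q z"
  shows "\<exists>m>0. touches_above \<phi> A m"
proof -
  define d where "d = (\<lambda>t. \<phi> t - gamma_log A p q t)"
  have "continuous_on {x..z} d"
    unfolding d_def using assms
    by (intro continuous_on_diff continuous_on_subset[OF assms(4)]
        continuous_on_subset[OF continuous_gamma_log]) auto
  then obtain s where s: "s \<in> {x..z}" "\<And>t. t \<in> {x..z} \<Longrightarrow> d t \<le> d s"
    using continuous_attains_sup[of "{x..z}" d] assms by auto
  define m where "m = (if s = x \<or> s = z then y else s)"
  have ends: "d x = 0" "d y = 0" "d z = 0"
    using eq by (auto simp: d_def)
  have m: "x < m" "m < z" "d m = d s"
    using s assms ends by (auto simp: m_def)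
  have "\<phi> m = gamma_log A p (q + d m) m"
    by (simp add: d_def gamma_log_def)
  moreover have "\<phi> t \<le> gamma_log A p (q + d m) t" if "t \<in> {x<..<z}" for t
    using s(2)[of t] that m by (simp add: d_def gamma_log_def)
  ultimately have "touches_above \<phi> A m"
    unfolding touches_above_def using m assms(1) by blast
  then show ?thesis using m assms by (intro exI[of _ m]) auto
qed

lemma touches_above_uminus: "touches_above (\<lambda>z. - \<phi> z) (- A) m \<Longrightarrow> touches_below \<phi> A m"
proof -
  assume "touches_above (\<lambda>z. - \<phi> z) (- A) m"
  then obtain p q l u where "0 < l" "l < m" "m < u" "- \<phi> m = gamma_log (- A) p q m"
    "\<forall>z\<in>{l<..<u}. - \<phi> z \<le> gamma_log (- A) p q z"
    unfolding touches_above_def by blast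
  moreover have "gamma_log (- A) p q z = - gamma_log A (- p) (- q) z" for z
    by (simp add: gamma_log_def)
  ultimately show ?thesis
    unfolding touches_below_def
    by (intro exI[of _ "- p"] exI[of _ "- q"] exI[of _ l] exI[of _ u]) auto
qed

lemma interpolant_touches_below:
  assumes "0 < x" "x < y" "y < z" "continuous_on {0<..} \<phi>"
    and "\<phi> x = gamma_log A p q x" "\<phi> y = gamma_log A p q y" "\<phi> z = gamma_log A p q z"
  shows "\<exists>m>0. touches_below \<phi> A m"
proof -
  have "\<exists>m>0. touches_above (\<lambda>z. - \<phi> z) (- A) m"
    using assms by (intro interpolant_touches_above[of x y z _ _ "- p" "- q"] continuous_on_minus)
      (auto simp: gamma_log_def)
  then show ?thesis using touches_above_uminus by blast
qed

text \<open>
  The interpolant of every triple touches both from above and from below, up to a vertical shift. So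
  the parameters of any two triples bound each other and are equal. Triples that contain 1 and 2
  determine the same \<open>p\<close> and \<open>q\<close> as well, and their third point is arbitrary.
\<close>

lemma gamma_log_if_touching_ordered:
  assumes cont: "continuous_on {0<..} \<phi>"
    and order: "\<And>A A' m m'. 0 < m \<Longrightarrow> 0 < m' \<Longrightarrow> touches_above \<phi> A m \<Longrightarrow> touches_below \<phi> A' m' \<Longrightarrow> A' \<le> A"
  shows "\<exists>A p q. \<forall>z>0. \<phi> z = gamma_log A p q z"
proof -
  have triple: "\<exists>A p q. \<phi> x = gamma_log A p q x \<and> \<phi> y = gamma_log A p q y \<and> \<phi> z = gamma_log A p q z
      \<and> (\<exists>m>0. touches_above \<phi> A m) \<and> (\<exists>m>0. touches_below \<phi> A m)"
    if xyz: "0 < x" "x < y" "y < z" for x y z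
  proof -
    obtain A p q where "\<phi> x = gamma_log A p q x" "\<phi> y = gamma_log A p q y" "\<phi> z = gamma_log A p q z"
      by (rule gamma_log_interpolation[OF xyz])
    then show ?thesis
      using interpolant_touches_above[OF xyz cont] interpolant_touches_below[OF xyz cont] by blast
  qed
  obtain A p q where 123: "\<phi> 1 = gamma_log A p q 1" "\<phi> 2 = gamma_log A p q 2"
    and A: "\<exists>m>0. touches_above \<phi> A m" "\<exists>m>0. touches_below \<phi> A m"
    using triple[of 1 2 3] by auto
  have "\<phi> t = gamma_log A p q t" if "0 < t" for t
  proof -
    consider "t = 1 \<or> t = 2" | "t < 1" | "1 < t" "t < 2" | "2 < t" by linarith
    then have "\<phi> t = gamma_log A p q t \<or>
      (\<exists>A p q. \<phi> 1 = gamma_log A p q 1 \<and> \<phi> 2 = gamma_log A p q 2 \<and> \<phi> t = gamma_log A p q t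
      \<and> (\<exists>m>0. touches_above \<phi> A m) \<and> (\<exists>m>0. touches_below \<phi> A m))"
    proof cases
      case 1
      then show ?thesis using 123 by auto
    next
      case 2
      then show ?thesis using triple[of t 1 2] that by auto
    next
      case 3
      then show ?thesis using triple[of 1 t 2] by auto
    next
      case 4
      then show ?thesis using triple[of 1 2 t] by auto
    qed
    then show ?thesis
    proof
      assume "\<exists>A p q. \<phi> 1 = gamma_log A p q 1 \<and> \<phi> 2 = gamma_log A p q 2 \<and> \<phi> t = gamma_log A p q t
        \<and> (\<exists>m>0. touches_above \<phi> A m) \<and> (\<exists>m>0. touches_below \<phi> A m)"
      then obtain A' p' q' where *: "\<phi> 1 = gamma_log A' p' q' 1" "\<phi> 2 = gamma_log A' p' q' 2"
        "\<phi> t = gamma_log A' p' q' t" "\<exists>m>0. touches_above \<phi> A' m" "\<exists>m>0. touches_below \<phi> A' m"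
        by blast
      have "A' = A"
        using A *(4,5) order by (meson order_antisym)
      moreover from this have "p' = p" "q' = q"
        using 123 *(1,2) by (auto simp: gamma_log_def)
      ultimately show ?thesis using *(3) by simp
    qed
  qed
  then show ?thesis by blast
qed

text \<open>
  Densities are determined only almost everywhere; continuity removes the exceptional set.
\<close>

lemma continuous_AE_eq_imp_eq:
  fixes g h :: "real \<Rightarrow> real"
  assumes "continuous_on {0<..} g" "continuous_on {0<..} h"
    and ae: "AE r in lborel. 0 < r \<longrightarrow> g r = h r" and "0 < r"
  shows "g r = h r"
proof (rule ccontr)
  assume ne: "g r \<noteq> h r"
  let ?U = "(\<lambda>x. g x - h x) -` (- {0}) \<inter> {0<..}"
  have "open ?U"
    using assms continuous_open_preimage[of "{0<..}" "\<lambda>x. g x - h x" "- {0}"]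
    by (auto simp: Int_commute intro!: continuous_on_diff)
  moreover have "r \<in> ?U" using ne assms(4) by simp
  ultimately obtain e where e: "0 < e" "ball r e \<subseteq> ?U"
    by (rule openE)
  have "AE x in lborel. x \<notin> ball r e"
    using ae by eventually_elim (use e in auto)
  then have "emeasure lborel (ball r e) = 0"
    by (subst (asm) AE_iff_measurable[of "ball r e"]) auto
  then show False
    using e(1) by (simp add: ball_eq_greaterThanLessThan)
qed

text \<open>
  A probability density cannot dominate \<open>K / x\<close> on long logarithmic intervals. This one estimate
  excludes too much mass near 0 and near infinity.
\<close>

lemma log_length_bound:
  assumes f: "f \<in> borel_measurable borel" and prob: "prob_space (density lborel (\<lambda>x. ennreal (f x)))"
    and "0 < a" "a \<le> b" "0 < K" and K: "\<And>x. a \<le> x \<Longrightarrow> x \<le> b \<Longrightarrow> K / x \<le> f x"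
  shows "K * (ln b - ln a) \<le> 1"
proof -
  have "(\<integral>\<^sup>+x. ennreal (K / x) * indicator {a..b} x \<partial>lborel) = ennreal (K * ln b - K * ln a)"
    using assms by (intro nn_integral_FTC_Icc)
      (auto intro!: derivative_eq_intros simp: has_real_derivative_iff_has_vector_derivative[symmetric])
  moreover have "(\<integral>\<^sup>+x. ennreal (K / x) * indicator {a..b} x \<partial>lborel) \<le> (\<integral>\<^sup>+x. ennreal (f x) \<partial>lborel)"
    using K by (intro nn_integral_mono) (auto intro: ennreal_leI split: split_indicator)
  moreover have "(\<integral>\<^sup>+x. ennreal (f x) \<partial>lborel) = 1"
    using prob_space.emeasure_space_1[OF prob] f by (simp add: emeasure_density)
  ultimately have "ennreal (K * ln b - K * ln a) \<le> ennreal 1"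
    by simp
  then show ?thesis
    by (simp add: ennreal_le_iff right_diff_distrib)
qed

lemma nn_integral_gamma_density:
  assumes "0 < c" "0 < b"
  shows "(\<integral>\<^sup>+x. ennreal (gamma_density c b x) \<partial>lborel) = 1"
proof -
  have G: "0 < Gamma c" using assms by (intro Gamma_real_pos)
  define h where "h = (\<lambda>t::real. if t \<in> {0..} then t powr (c - 1) / exp t else 0)"
  have [measurable]: "h \<in> borel_measurable borel" unfolding h_def by measurable
  have "(h has_integral Gamma c) UNIV"
    unfolding h_def has_integral_restrict_UNIV by (rule Gamma_integral_real[OF assms(1)])
  then have h: "(\<integral>\<^sup>+t. ennreal (h t) \<partial>lborel) = ennreal (Gamma c)"
    by (intro nn_integral_has_integral_lborel) (auto simp: h_def)
  have "(\<integral>\<^sup>+x. ennreal (gamma_density c b x) \<partial>lborel)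
      = ennreal \<bar>b\<bar> * (\<integral>\<^sup>+t. ennreal (gamma_density c b (0 + b * t)) \<partial>lborel)"
    using assms by (intro nn_integral_real_affine) auto
  also have "\<dots> = (\<integral>\<^sup>+t. ennreal \<bar>b\<bar> * ennreal (gamma_density c b (0 + b * t)) \<partial>lborel)"
    by (intro nn_integral_cmult[symmetric]) measurable
  also have "\<dots> = (\<integral>\<^sup>+t. ennreal (1 / Gamma c) * ennreal (h t) \<partial>lborel)"
  proof (rule nn_integral_cong)
    fix t :: real
    have "\<bar>b\<bar> * gamma_density c b (0 + b * t) = 1 / Gamma c * h t"
    proof (cases "0 < t")
      case True
      have "b * b powr (c - 1) = b powr c"
        using assms powr_mult_base[of b "c - 1"] by simp
      then show ?thesis
        using True assms G
        by (simp add: gamma_density_def h_def powr_mult exp_minus zero_less_mult_iff divide_simps)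
    next
      case False
      then show ?thesis
        using assms by (cases "t = 0") (auto simp: gamma_density_def h_def zero_less_mult_iff)
    qed
    then show "ennreal \<bar>b\<bar> * ennreal (gamma_density c b (0 + b * t)) = ennreal (1 / Gamma c) * ennreal (h t)"
      using G by (simp add: h_def gamma_density_def flip: ennreal_mult'')
  qed
  also have "\<dots> = ennreal (1 / Gamma c) * ennreal (Gamma c)"
    by (subst nn_integral_cmult) (simp_all add: h)
  also have "\<dots> = 1"
    using G by (simp flip: ennreal_mult)
  finally show ?thesis .
qed

text \<open>
  For \<open>A \<ge> 1\<close> the density dominates a multiple of \<open>1 / x\<close> on \<open>(0, 1]\<close>, and for \<open>A < 1\<close> and \<open>p \<ge> 0\<close> it
  does so on \<open>[1, \<infinity>)\<close>. In the remaining case it is a multiple of a gamma density, and the multiple is 1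
  as both have total mass 1.
\<close>

lemma gamma_distribution_if_gamma_log:
  assumes f [measurable]: "f \<in> borel_measurable borel"
    and prob: "prob_space (density lborel (\<lambda>x. ennreal (f x)))"
    and f0: "\<And>x. x \<le> 0 \<Longrightarrow> f x = 0" and f_pos: "\<And>x. 0 < x \<Longrightarrow> f x = exp (gamma_log A p q x)"
  shows "gamma_distribution (density lborel (\<lambda>x. ennreal (f x)))"
proof -
  have fx: "f x = exp q * (x powr (- A) * exp (p * x))" if "0 < x" for x
    using that by (simp add: f_pos gamma_log_def powr_def exp_add exp_diff exp_minus field_simps)
  have A: "A < 1"
  proof (rule ccontr)
    assume "\<not> A < 1"
    (* The interval [exp (- 2 / K), 1] has logarithmic length 2 / K, twice what is possible. *)
    define K where "K = exp q * exp (- \<bar>p\<bar>)"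
    have "K * (ln 1 - ln (exp (- (2 / K)))) \<le> 1"
    proof (rule log_length_bound[OF f prob])
      fix x assume "exp (- (2 / K)) \<le> x" "x \<le> 1"
      then have x: "0 < x" "x \<le> 1" using exp_gt_zero[of "- (2 / K)"] by linarith+
      have "1 / x = x powr (- 1)" using x by (simp add: powr_minus inverse_eq_divide)
      also have "\<dots> \<le> x powr (- A)" using x \<open>\<not> A < 1\<close> by (intro powr_mono') auto
      finally have 1: "1 / x \<le> x powr (- A)" .
      have "\<bar>p * x\<bar> \<le> \<bar>p\<bar>" using x by (simp add: abs_mult mult_left_le)
      then have "exp (- \<bar>p\<bar>) \<le> exp (p * x)" by simp
      with 1 have "(1 / x) * exp (- \<bar>p\<bar>) \<le> x powr (- A) * exp (p * x)"
        using x by (intro mult_mono) auto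
      then have "exp q * ((1 / x) * exp (- \<bar>p\<bar>)) \<le> f x"
        unfolding fx[OF x(1)] by (intro mult_left_mono) auto
      then show "K / x \<le> f x" by (simp add: K_def)
    qed (auto simp: K_def)
    moreover have "0 < K" by (simp add: K_def)
    ultimately show False by simp
  qed
  have p: "p < 0"
  proof (rule ccontr)
    assume "\<not> p < 0"
    define K where "K = exp q"
    have "K * (ln (exp (2 / K)) - ln 1) \<le> 1"
    proof (rule log_length_bound[OF f prob])
      fix x :: real assume x: "1 \<le> x"
      have "1 / x = x powr (- 1)" using x by (simp add: powr_minus inverse_eq_divide)
      also have "\<dots> \<le> x powr (- A)" using x A by (intro powr_mono) auto
      finally have "(1 / x) * 1 \<le> x powr (- A) * exp (p * x)"
        using x \<open>\<not> p < 0\<close> by (intro mult_mono) auto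
      then have "exp q * ((1 / x) * 1) \<le> f x"
        unfolding fx[OF order_less_le_trans[OF zero_less_one x]] by (intro mult_left_mono) auto
      then show "K / x \<le> f x" by (simp add: K_def)
    qed (auto simp: K_def)
    moreover have "0 < K" by (simp add: K_def)
    ultimately show False by simp
  qed
  define c where "c = 1 - A"
  define b where "b = - 1 / p"
  have cb: "0 < c" "0 < b" using A p by (auto simp: c_def b_def)
  have G: "0 < Gamma c" using cb by (intro Gamma_real_pos)
  define E where "E = Gamma c * b powr c"
  have E: "0 < E" using G cb by (simp add: E_def)
  define D where "D = exp q * E"
  have D: "0 < D" using E by (simp add: D_def)
  have fD: "f x = D * gamma_density c b x" for x
  proof (cases "0 < x")
    case True
    have "- x / b = p * x" "- A = c - 1" using p by (simp_all add: b_def c_def)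
    then have "gamma_density c b x = 1 / E * (x powr (- A) * exp (p * x))"
      using True by (simp add: gamma_density_def E_def)
    then show ?thesis
      using True E by (simp add: fx D_def)
  qed (simp add: f0 gamma_density_def)
  have "1 = (\<integral>\<^sup>+x. ennreal (f x) \<partial>lborel)"
    using prob_space.emeasure_space_1[OF prob] by (simp add: emeasure_density)
  also have "\<dots> = (\<integral>\<^sup>+x. ennreal D * ennreal (gamma_density c b x) \<partial>lborel)"
    using D G by (simp add: fD ennreal_mult')
  also have "\<dots> = ennreal D"
    using nn_integral_gamma_density[OF cb] by (simp add: nn_integral_cmult)
  finally have "D = 1" by simp
  then show ?thesis
    unfolding gamma_distribution_def using cb fD by auto
qed

section \<open>Angular integrals\<close>

text \<open>
  Up to the factor \<open>r\<^sup>n\<^sup>-\<^sup>1\<close>, the density at \<open>r\<close> of the sample mean on the event that the direction of the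
  sample lies in \<open>C\<close>.
\<close>

definition angular :: "nat \<Rightarrow> (real \<Rightarrow> real) \<Rightarrow> (nat \<Rightarrow> real) set \<Rightarrow> real \<Rightarrow> real" where
  "angular n f C r = (\<integral>\<omega>. indicator C \<omega> * (\<Prod>i\<in>{1..n}. f (r * \<omega> i)) \<partial>simplex_measure n)"

definition log_defect :: "nat \<Rightarrow> (nat \<Rightarrow> real) \<Rightarrow> real" where
  "log_defect n \<omega> = - (\<Sum>i = 1..n. ln (\<omega> i))"

text \<open>
  Only directions that carry the simplex measure are constrained, so that a set defined by a
  scale-invariant condition, which is a cone, can be a cap.
\<close>

definition cap :: "nat \<Rightarrow> real \<Rightarrow> (nat \<Rightarrow> real) set \<Rightarrow> bool" where
  "cap n d C \<longleftrightarrow> C \<in> sets (Leb n) \<and>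
     (\<forall>\<omega>\<in>C. \<omega> \<in> orthant n \<longrightarrow> avg n \<omega> = 1 \<longrightarrow> (\<forall>i\<in>{1..n}. \<bar>\<omega> i - 1\<bar> \<le> d))"

lemma abs_mult_diff:
  fixes m w :: real
  assumes "0 < m"
  shows "\<bar>m * w - m\<bar> = m * \<bar>w - 1\<bar>"
proof -
  have "m * w - m = m * (w - 1)" by (simp add: right_diff_distrib)
  then show ?thesis using assms by (simp add: abs_mult)
qed

lemma capD: "cap n d C \<Longrightarrow> \<omega> \<in> C \<Longrightarrow> \<omega> \<in> orthant n \<Longrightarrow> avg n \<omega> = 1 \<Longrightarrow> i \<in> {1..n} \<Longrightarrow> \<bar>\<omega> i - 1\<bar> \<le> d"
  unfolding cap_def by blast

lemma cap_mono: "cap n d C \<Longrightarrow> d \<le> d' \<Longrightarrow> cap n d' C"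
  unfolding cap_def by force

lemma integrable_on_cap:
  assumes n: "0 < n" and C: "C \<in> sets (Leb n)" and g: "g \<in> borel_measurable (Leb n)"
    and bound: "\<And>\<omega>. \<omega> \<in> C \<Longrightarrow> \<omega> \<in> orthant n \<Longrightarrow> avg n \<omega> = 1 \<Longrightarrow> \<bar>g \<omega>\<bar> \<le> b"
  shows "integrable (simplex_measure n) (\<lambda>\<omega>. indicator C \<omega> * g \<omega> :: real)"
proof -
  interpret S: finite_measure "simplex_measure n" by (rule finite_simplex_measure[OF n])
  note [measurable] = C g
  show ?thesis
  proof (rule S.integrable_const_bound[of _ "\<bar>b\<bar>"])
    show "AE \<omega> in simplex_measure n. norm (indicator C \<omega> * g \<omega>) \<le> \<bar>b\<bar>"
      using AE_simplex_measure[OF n]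
    proof eventually_elim
      case (elim \<omega>)
      then show ?case using bound[of \<omega>] by (auto split: split_indicator)
    qed
    show "(\<lambda>\<omega>. indicator C \<omega> * g \<omega>) \<in> borel_measurable (simplex_measure n)"
      by measurable
  qed
qed

lemma integral_mono_on_cap:
  assumes n: "0 < n"
    and int: "integrable (simplex_measure n) (\<lambda>\<omega>. indicator C \<omega> * g \<omega> :: real)"
      "integrable (simplex_measure n) (\<lambda>\<omega>. indicator C \<omega> * h \<omega> :: real)"
    and le: "\<And>\<omega>. \<omega> \<in> C \<Longrightarrow> \<omega> \<in> orthant n \<Longrightarrow> avg n \<omega> = 1 \<Longrightarrow> g \<omega> \<le> h \<omega>"
  shows "(\<integral>\<omega>. indicator C \<omega> * g \<omega> \<partial>simplex_measure n) \<le> (\<integral>\<omega>. indicator C \<omega> * h \<omega> \<partial>simplex_measure n)"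
proof (rule integral_mono_AE[OF int])
  show "AE \<omega> in simplex_measure n. indicator C \<omega> * g \<omega> \<le> indicator C \<omega> * h \<omega>"
    using AE_simplex_measure[OF n]
  proof eventually_elim
    case (elim \<omega>)
    then show ?case using le[of \<omega>] by (auto split: split_indicator)
  qed
qed

text \<open>
  On a cap of radius 1/2 the coordinates lie in \<open>[1/2, 3/2]\<close>, so for \<open>r\<close> in a compact set the
  arguments of \<open>f\<close> stay in a compact subset of the positive axis. The bound dominates all the integrals
  below.
\<close>

lemma prod_bounded_on_cap:
  assumes f: "continuous_on {0<..} f" and K: "compact K" "K \<subseteq> {0<..}" and C: "cap n (1 / 2) C"
  obtains b :: real where "\<And>r \<omega>. r \<in> K \<Longrightarrow> \<omega> \<in> C \<Longrightarrow> \<omega> \<in> orthant n \<Longrightarrow> avg n \<omega> = 1 \<Longrightarrow>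
    \<bar>\<Prod>i\<in>{1..n}. f (r * \<omega> i)\<bar> \<le> b"
proof -
  let ?L = "(\<lambda>(r, w). r * w) ` (K \<times> {1 / 2..3 / 2})"
  have "compact ?L"
    using K(1) by (intro compact_continuous_image compact_Times)
      (auto simp: case_prod_unfold intro!: continuous_intros)
  moreover have "?L \<subseteq> {0<..}" using K(2) by (auto simp: zero_less_mult_iff)
  ultimately have "bounded (f ` ?L)"
    by (intro compact_imp_bounded[OF compact_continuous_image[OF continuous_on_subset[OF f]]])
  then obtain b where "\<forall>y\<in>f ` ?L. norm y \<le> b"
    unfolding bounded_iff by blast
  then have b: "\<bar>f x\<bar> \<le> b" if "x \<in> ?L" for x
    using that by (metis imageI real_norm_def)
  show thesis
  proof
    fix r \<omega> assume *: "r \<in> K" "\<omega> \<in> C" "\<omega> \<in> orthant n" "avg n \<omega> = 1"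
    have "\<bar>f (r * \<omega> i)\<bar> \<le> b" if "i \<in> {1..n}" for i
    proof (rule b)
      have "\<omega> i \<in> {1 / 2..3 / 2}"
        using capD[OF C *(2-4) that] by (auto simp: abs_if split: if_splits)
      then show "r * \<omega> i \<in> ?L" using *(1) by force
    qed
    then have "(\<Prod>i\<in>{1..n}. \<bar>f (r * \<omega> i)\<bar>) \<le> (\<Prod>i\<in>{1..n}. b)"
      by (intro prod_mono) auto
    then show "\<bar>\<Prod>i\<in>{1..n}. f (r * \<omega> i)\<bar> \<le> b ^ n"
      by (simp add: abs_prod)
  qed
qed

lemma prod_measurable [measurable]:
  assumes [measurable]: "f \<in> borel_measurable borel"
  shows "(\<lambda>\<omega>. \<Prod>i\<in>{1..n}. f (r * \<omega> i) :: real) \<in> borel_measurable (Leb n)"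
  by measurable

lemma integrable_angular:
  fixes f :: "real \<Rightarrow> real"
  assumes n: "0 < n" and f: "f \<in> borel_measurable borel" "continuous_on {0<..} f"
    and C: "cap n (1 / 2) C" and r: "0 < r"
  shows "integrable (simplex_measure n) (\<lambda>\<omega>. indicator C \<omega> * (\<Prod>i\<in>{1..n}. f (r * \<omega> i)))"
proof -
  obtain b where "\<And>s \<omega>. s \<in> {r} \<Longrightarrow> \<omega> \<in> C \<Longrightarrow> \<omega> \<in> orthant n \<Longrightarrow> avg n \<omega> = 1 \<Longrightarrow>
    \<bar>\<Prod>i\<in>{1..n}. f (s * \<omega> i)\<bar> \<le> b"
    by (rule prod_bounded_on_cap[OF f(2) _ _ C, of "{r}"]) (use r in auto)
  then show ?thesis
    using C f by (intro integrable_on_cap[OF n, where b = b] prod_measurable) (auto simp: cap_def)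
qed

text \<open>
  Dominated convergence; a convergent sequence together with its limit is a compact set of radii.
\<close>

lemma continuous_angular:
  fixes f :: "real \<Rightarrow> real"
  assumes n: "0 < n" and f: "f \<in> borel_measurable borel" "continuous_on {0<..} f"
    and C: "cap n (1 / 2) C"
  shows "continuous_on {0<..} (angular n f C)"
proof (rule continuous_on_sequentiallyI)
  fix u :: "nat \<Rightarrow> real" and r assume u: "\<forall>k. u k \<in> {0<..}" "r \<in> {0<..}" "u \<longlonglongrightarrow> r"
  interpret S: finite_measure "simplex_measure n" by (rule finite_simplex_measure[OF n])
  have C': "C \<in> sets (simplex_measure n)" using C by (simp add: cap_def)
  obtain b where b: "\<And>s \<omega>. s \<in> insert r (range u) \<Longrightarrow> \<omega> \<in> C \<Longrightarrow> \<omega> \<in> orthant n \<Longrightarrow> avg n \<omega> = 1 \<Longrightarrow>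
    \<bar>\<Prod>i\<in>{1..n}. f (s * \<omega> i)\<bar> \<le> b"
    by (rule prod_bounded_on_cap[OF f(2) compact_sequence_with_limit[OF u(3)] _ C]) (use u in auto)
  show "(\<lambda>k. angular n f C (u k)) \<longlonglongrightarrow> angular n f C r"
    unfolding angular_def
  proof (rule integral_dominated_convergence[where w = "\<lambda>_. \<bar>b\<bar>"])
    show "(\<lambda>\<omega>. indicator C \<omega> * (\<Prod>i\<in>{1..n}. f (r * \<omega> i))) \<in> borel_measurable (simplex_measure n)"
      and "(\<lambda>\<omega>. indicator C \<omega> * (\<Prod>i\<in>{1..n}. f (u k * \<omega> i))) \<in> borel_measurable (simplex_measure n)" for k
      using C' f(1) by measurable
    show "AE \<omega> in simplex_measure n. (\<lambda>k. indicator C \<omega> * (\<Prod>i\<in>{1..n}. f (u k * \<omega> i)))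
        \<longlonglongrightarrow> indicator C \<omega> * (\<Prod>i\<in>{1..n}. f (r * \<omega> i))"
      using AE_simplex_measure[OF n]
    proof eventually_elim
      case (elim \<omega>)
      show ?case
      proof (intro tendsto_mult tendsto_const tendsto_prod)
        fix i assume "i \<in> {1..n}"
        then have "0 < \<omega> i" using elim by (auto simp: orthant_def)
        then have "isCont f (r * \<omega> i)"
          using f(2) u(2) by (intro continuous_on_interior[of "{0<..}"]) (auto simp: interior_open)
        then show "(\<lambda>k. f (u k * \<omega> i)) \<longlonglongrightarrow> f (r * \<omega> i)"
          by (rule isCont_tendsto_compose) (intro tendsto_intros u)
      qed
    qed
    show "AE \<omega> in simplex_measure n. norm (indicator C \<omega> * (\<Prod>i\<in>{1..n}. f (u k * \<omega> i))) \<le> \<bar>b\<bar>" for k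
      using AE_simplex_measure[OF n]
    proof eventually_elim
      case (elim \<omega>)
      then show ?case using b[of "u k" \<omega>] by (auto split: split_indicator)
    qed
  qed simp
qed

lemma angular_bounds:
  fixes f :: "real \<Rightarrow> real"
  assumes n: "0 < n" and f: "f \<in> borel_measurable borel" "continuous_on {0<..} f"
    and C: "cap n (1 / 2) C" and r: "0 < r"
    and bounds: "\<And>\<omega>. \<omega> \<in> C \<Longrightarrow> \<omega> \<in> orthant n \<Longrightarrow> avg n \<omega> = 1 \<Longrightarrow> lo \<le> (\<Prod>i\<in>{1..n}. f (r * \<omega> i)) \<and> (\<Prod>i\<in>{1..n}. f (r * \<omega> i)) \<le> hi"
  shows "lo * measure (simplex_measure n) C \<le> angular n f C r"
    and "angular n f C r \<le> hi * measure (simplex_measure n) C"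
proof -
  interpret S: finite_measure "simplex_measure n" by (rule finite_simplex_measure[OF n])
  have C': "C \<in> sets (simplex_measure n)" using C by (simp add: cap_def)
  have "integrable (simplex_measure n) (indicat_real C)"
    by (intro integrable_real_indicator C') (simp add: S.emeasure_eq_measure)
  then have const: "integrable (simplex_measure n) (\<lambda>\<omega>. indicator C \<omega> * c :: real)"
    "(\<integral>\<omega>. indicator C \<omega> * c \<partial>simplex_measure n) = c * measure (simplex_measure n) C" for c
    using sets.Int_space_eq2[OF C'] by (simp_all add: mult.commute)
  show "lo * measure (simplex_measure n) C \<le> angular n f C r"
    unfolding angular_def const(2)[symmetric]
    by (rule integral_mono_on_cap[OF n const(1) integrable_angular[OF n f C r]]) (use bounds in auto)
  show "angular n f C r \<le> hi * measure (simplex_measure n) C"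
    unfolding angular_def const(2)[symmetric]
    by (rule integral_mono_on_cap[OF n integrable_angular[OF n f C r] const(1)]) (use bounds in auto)
qed

text \<open>
  On shrinking caps all the factors \<open>f(m \<omega>\<^sub>i)\<close> are uniformly close to \<open>f(m)\<close>.
\<close>

lemma angular_asymptotics:
  fixes f :: "real \<Rightarrow> real"
  assumes n: "0 < n" and f: "f \<in> borel_measurable borel" "continuous_on {0<..} f"
    and f_pos: "\<And>x. 0 < x \<Longrightarrow> 0 < f x" and m: "0 < m"
    and C: "\<And>k. cap n (1 / real (k + 2)) (C k)" and pos: "\<And>k. 0 < measure (simplex_measure n) (C k)"
  shows "(\<lambda>k. angular n f (C k) m / measure (simplex_measure n) (C k)) \<longlonglongrightarrow> f m ^ n"
proof (rule LIMSEQ_I)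
  fix e :: real assume e: "0 < e"
  have "isCont (\<lambda>t::real. t ^ n) (f m)" by simp
  then obtain d where d: "0 < d" "\<And>t. \<bar>t - f m\<bar> < d \<Longrightarrow> \<bar>t ^ n - f m ^ n\<bar> < e"
    using e unfolding continuous_at_eps_delta dist_real_def by blast
  (* d' is at most f m so that the lower bounds f m - d' of the factors are nonnegative and may be
     multiplied. *)
  define d' where "d' = min (d / 2) (f m)"
  have d': "0 < d'" "d' < d" "d' \<le> f m" using d(1) f_pos[OF m] by (auto simp: d'_def)
  have "isCont f m"
    using f(2) m by (intro continuous_on_interior[of "{0<..}"]) (auto simp: interior_open)
  then obtain s where s: "0 < s" "\<And>x. \<bar>x - m\<bar> < s \<Longrightarrow> \<bar>f x - f m\<bar> < d'"
    using d'(1) unfolding continuous_at_eps_delta dist_real_def by blast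
  have "(\<lambda>k. m * (1 / real (k + 2))) \<longlonglongrightarrow> m * 0"
    by (intro tendsto_intros LIMSEQ_ignore_initial_segment[where k = 2] lim_1_over_n)
  then have "eventually (\<lambda>k. m * (1 / real (k + 2)) < s) sequentially"
    using s(1) by (intro order_tendstoD(2)[of _ "m * 0"]) auto
  then obtain N where N: "\<And>k. N \<le> k \<Longrightarrow> m * (1 / real (k + 2)) < s"
    unfolding eventually_sequentially by blast
  show "\<exists>N. \<forall>k\<ge>N. norm (angular n f (C k) m / measure (simplex_measure n) (C k) - f m ^ n) < e"
  proof (intro exI allI impI)
    fix k assume k: "N \<le> k"
    have C2: "cap n (1 / 2) (C k)" by (rule cap_mono[OF C]) simp
    have prod: "(f m - d') ^ n \<le> (\<Prod>i\<in>{1..n}. f (m * \<omega> i)) \<and> (\<Prod>i\<in>{1..n}. f (m * \<omega> i)) \<le> (f m + d') ^ n"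
      if \<omega>: "\<omega> \<in> C k" "\<omega> \<in> orthant n" "avg n \<omega> = 1" for \<omega>
    proof -
      have "f m - d' \<le> f (m * \<omega> i) \<and> f (m * \<omega> i) \<le> f m + d'" if i: "i \<in> {1..n}" for i
      proof -
        have "\<bar>m * \<omega> i - m\<bar> = m * \<bar>\<omega> i - 1\<bar>"
          by (rule abs_mult_diff[OF m])
        also have "\<dots> \<le> m * (1 / real (k + 2))"
          using capD[OF C \<omega> i] m by (intro mult_left_mono) auto
        finally show ?thesis using s(2)[of "m * \<omega> i"] N[OF k] by (auto simp: abs_if split: if_splits)
      qed
      then have "0 \<le> f m - d' \<and> f m - d' \<le> f (m * \<omega> i)" "0 \<le> f (m * \<omega> i) \<and> f (m * \<omega> i) \<le> f m + d'"
        if "i \<in> {1..n}" for i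
        using that d'(3) by force+
      then have "(\<Prod>i\<in>{1..n}. f m - d') \<le> (\<Prod>i\<in>{1..n}. f (m * \<omega> i))
          \<and> (\<Prod>i\<in>{1..n}. f (m * \<omega> i)) \<le> (\<Prod>i\<in>{1..n}. f m + d')"
        by (intro conjI prod_mono; blast)
      then show ?thesis by simp
    qed
    let ?q = "angular n f (C k) m / measure (simplex_measure n) (C k)"
    have "(f m - d') ^ n \<le> ?q" "?q \<le> (f m + d') ^ n"
      using angular_bounds[OF n f C2 m prod] pos[of k] by (simp_all only: pos_le_divide_eq pos_divide_le_eq)
    moreover have "\<bar>(f m - d') ^ n - f m ^ n\<bar> < e" "\<bar>(f m + d') ^ n - f m ^ n\<bar> < e"
      by (rule d(2), use d' in simp)+
    ultimately show "norm (?q - f m ^ n) < e"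
      unfolding real_norm_def by linarith
  qed
qed

lemma log_defect_measurable [measurable]: "log_defect n \<in> borel_measurable (Leb n)"
  unfolding log_defect_def[abs_def] by measurable

lemma integrable_exp_log_defect:
  assumes n: "0 < n" and C: "cap n (1 / 2) C"
  shows "integrable (simplex_measure n) (\<lambda>\<omega>. indicator C \<omega> * exp (A * log_defect n \<omega>))"
proof (rule integrable_on_cap[OF n])
  show "C \<in> sets (Leb n)" using C by (simp add: cap_def)
  show "(\<lambda>\<omega>. exp (A * log_defect n \<omega>)) \<in> borel_measurable (Leb n)" by measurable
  fix \<omega> assume \<omega>: "\<omega> \<in> C" "\<omega> \<in> orthant n" "avg n \<omega> = 1"
  have "\<bar>ln (\<omega> i)\<bar> \<le> 1" if i: "i \<in> {1..n}" for i
  proof -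
    have w: "1 / 2 \<le> \<omega> i" "\<omega> i \<le> 3 / 2"
      using capD[OF C \<omega> i] by (auto simp: abs_if split: if_splits)
    have "ln (\<omega> i) \<le> \<omega> i - 1" using w by (intro ln_le_minus_one) auto
    moreover have "ln (1 / \<omega> i) \<le> 1 / \<omega> i - 1" using w by (intro ln_le_minus_one) auto
    moreover have "1 / \<omega> i \<le> 2" using w by (simp add: divide_simps)
    moreover have "ln (1 / \<omega> i) = - ln (\<omega> i)" using w by (simp add: ln_div)
    ultimately show ?thesis using w by (auto simp: abs_if)
  qed
  then have "(\<Sum>i = 1..n. \<bar>ln (\<omega> i)\<bar>) \<le> (\<Sum>i = 1..n. 1)"
    by (intro sum_mono) auto
  then have "\<bar>log_defect n \<omega>\<bar> \<le> real n"
    using order_trans[OF sum_abs, of "\<lambda>i. ln (\<omega> i)" "{1..n}" "real n"] by (simp add: log_defect_def)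
  then have "\<bar>A * log_defect n \<omega>\<bar> \<le> \<bar>A\<bar> * real n"
    by (simp add: abs_mult mult_left_mono)
  then show "\<bar>exp (A * log_defect n \<omega>)\<bar> \<le> exp (\<bar>A\<bar> * real n)" by simp
qed

text \<open>
  The inequality of the arithmetic and the geometric mean, from \<open>ln x \<le> x - 1\<close> with equality only at
  1.
\<close>

lemma log_defect_nonneg:
  assumes n: "0 < n" and \<omega>: "\<omega> \<in> orthant n" "avg n \<omega> = 1"
  shows "0 \<le> log_defect n \<omega>" and "i \<in> {1..n} \<Longrightarrow> \<omega> i \<noteq> 1 \<Longrightarrow> 0 < log_defect n \<omega>"
proof -
  have pos: "0 < \<omega> i" if "i \<in> {1..n}" for i using \<omega> that by (auto simp: orthant_def)
  have le: "ln (\<omega> i) \<le> \<omega> i - 1" if "i \<in> {1..n}" for i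
    using pos[OF that] by (rule ln_le_minus_one)
  have zero: "(\<Sum>i = 1..n. \<omega> i - 1) = 0"
    using \<omega>(2) n by (simp add: sample_mean_def sum_subtractf)
  have "(\<Sum>i = 1..n. ln (\<omega> i)) \<le> (\<Sum>i = 1..n. \<omega> i - 1)"
    using le by (rule sum_mono)
  then show "0 \<le> log_defect n \<omega>" using zero by (simp add: log_defect_def)
  assume i: "i \<in> {1..n}" "\<omega> i \<noteq> 1"
  have "ln (\<omega> i) \<noteq> \<omega> i - 1"
    using ln_eq_minus_one[OF pos[OF i(1)]] i(2) by blast
  then have "ln (\<omega> i) < \<omega> i - 1" using le[OF i(1)] by simp
  then have "(\<Sum>i = 1..n. ln (\<omega> i)) < (\<Sum>i = 1..n. \<omega> i - 1)"
    using le i(1) by (intro sum_strict_mono_ex1) auto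
  then show "0 < log_defect n \<omega>" using zero by (simp add: log_defect_def)
qed

lemma integral_exp_log_defect_strict_mono:
  assumes n: "2 \<le> n" and C: "cap n (1 / 2) C"
    and D: "D \<in> sets (Leb n)" "emeasure (simplex_measure n) D \<noteq> 0" "\<And>\<omega>. \<omega> \<in> D \<Longrightarrow> \<omega> \<in> C \<and> \<omega> 1 \<noteq> \<omega> 2"
    and "A < A'"
  shows "(\<integral>\<omega>. indicator C \<omega> * exp (A * log_defect n \<omega>) \<partial>simplex_measure n)
    < (\<integral>\<omega>. indicator C \<omega> * exp (A' * log_defect n \<omega>) \<partial>simplex_measure n)"
proof -
  have n0: "0 < n" using n by simp
  interpret S: finite_measure "simplex_measure n" by (rule finite_simplex_measure[OF n0])
  show ?thesis
  proof (rule S.integral_less_AE[where A = D])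
    show "AE \<omega> in simplex_measure n. \<omega> \<in> D \<longrightarrow>
      indicator C \<omega> * exp (A * log_defect n \<omega>) \<noteq> indicator C \<omega> * exp (A' * log_defect n \<omega>)"
      using AE_simplex_measure[OF n0]
    proof eventually_elim
      case (elim \<omega>)
      show ?case
      proof
        assume "\<omega> \<in> D"
        then have *: "\<omega> \<in> C" "\<omega> 1 \<noteq> \<omega> 2" using D(3) by auto
        then have "\<omega> 1 \<noteq> 1 \<or> \<omega> 2 \<noteq> 1" by auto
        then have "0 < log_defect n \<omega>"
          using log_defect_nonneg(2)[OF n0, of \<omega> 1] log_defect_nonneg(2)[OF n0, of \<omega> 2] elim n by auto
        then show "indicator C \<omega> * exp (A * log_defect n \<omega>) \<noteq> indicator C \<omega> * exp (A' * log_defect n \<omega>)"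
          using * \<open>A < A'\<close> by simp
      qed
    qed
    show "AE \<omega> in simplex_measure n. indicator C \<omega> * exp (A * log_defect n \<omega>) \<le> indicator C \<omega> * exp (A' * log_defect n \<omega>)"
      using AE_simplex_measure[OF n0]
    proof eventually_elim
      case (elim \<omega>)
      then show ?case
        using log_defect_nonneg(1)[OF n0, of \<omega>] \<open>A < A'\<close>
        by (auto intro!: mult_right_mono split: split_indicator)
    qed
  qed (simp_all add: D(1,2) integrable_exp_log_defect[OF n0 C])
qed

text \<open>
  The reason why gamma-type functions are the right comparison functions: relative to
  \<open>n\<close> times the value at the mean, the sum over the coordinates does not depend on \<open>m\<close>, \<open>p\<close> or \<open>q\<close>.
\<close>

lemma sum_gamma_log:
  assumes n: "0 < n" and m: "0 < m" and \<omega>: "\<omega> \<in> orthant n" "avg n \<omega> = 1"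
  shows "(\<Sum>i = 1..n. gamma_log A p q (m * \<omega> i)) = real n * gamma_log A p q m + A * log_defect n \<omega>"
proof -
  have sum: "(\<Sum>i = 1..n. \<omega> i) = real n"
    using \<omega>(2) n by (simp add: sample_mean_def)
  have "(\<Sum>i = 1..n. gamma_log A p q (m * \<omega> i)) = (\<Sum>i = 1..n. p * m * \<omega> i + (q - A * ln m) - A * ln (\<omega> i))"
  proof (rule sum.cong[OF refl])
    fix i assume "i \<in> {1..n}"
    then have "0 < \<omega> i" using \<omega>(1) by (auto simp: orthant_def)
    then show "gamma_log A p q (m * \<omega> i) = p * m * \<omega> i + (q - A * ln m) - A * ln (\<omega> i)"
      using m by (simp add: gamma_log_def ln_mult algebra_simps)
  qed
  also have "\<dots> = p * m * (\<Sum>i = 1..n. \<omega> i) + real n * (q - A * ln m) - A * (\<Sum>i = 1..n. ln (\<omega> i))"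
    by (simp add: sum.distrib sum_subtractf sum_distrib_left)
  also have "\<dots> = real n * gamma_log A p q m + A * log_defect n \<omega>"
    unfolding sum by (simp add: gamma_log_def log_defect_def algebra_simps)
  finally show ?thesis .
qed

lemma eventually_window:
  fixes l m u :: real
  assumes "l < m" "m < u" "0 < m"
  shows "eventually (\<lambda>k. \<forall>w. \<bar>w - 1\<bar> \<le> 1 / real (k + 2) \<longrightarrow> m * w \<in> {l<..<u}) sequentially"
proof -
  have "(\<lambda>k. m * (1 / real (k + 2))) \<longlonglongrightarrow> m * 0"
    by (intro tendsto_intros LIMSEQ_ignore_initial_segment[where k = 2] lim_1_over_n)
  then have "eventually (\<lambda>k. m * (1 / real (k + 2)) < min (m - l) (u - m)) sequentially"
    using assms by (intro order_tendstoD(2)[of _ "m * 0"]) auto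
  then show ?thesis
  proof eventually_elim
    case (elim k)
    show ?case
    proof (intro allI impI)
      fix w :: real assume "\<bar>w - 1\<bar> \<le> 1 / real (k + 2)"
      then have "m * \<bar>w - 1\<bar> \<le> m * (1 / real (k + 2))"
        using assms by (intro mult_left_mono) auto
      then have "\<bar>m * w - m\<bar> \<le> m * (1 / real (k + 2))"
        by (simp only: abs_mult_diff[OF assms(3)])
      then show "m * w \<in> {l<..<u}"
        using elim by (auto simp: abs_if split: if_splits)
    qed
  qed
qed

lemma integral_indicator_mult_const:
  "(\<integral>\<omega>. indicator C \<omega> * (c * g \<omega>) \<partial>M) = c * (\<integral>\<omega>. indicator C \<omega> * g \<omega> \<partial>M)" for c :: real
  by (subst integral_mult_right_zero[symmetric]) (simp only: mult.left_commute)

text \<open>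
  The comparison is only local, but on a small cap all points \<open>m \<omega>\<^sub>i\<close> lie in the window in which the
  touching function dominates.
\<close>

lemma angular_le_if_touches_above:
  fixes f :: "real \<Rightarrow> real"
  assumes n: "0 < n" and f: "f \<in> borel_measurable borel" "continuous_on {0<..} f"
    and f_pos: "\<And>x. 0 < x \<Longrightarrow> 0 < f x" and m: "0 < m"
    and C: "\<And>k. cap n (1 / real (k + 2)) (C k)"
    and touch: "touches_above (\<lambda>x. ln (f x)) A m"
  shows "\<forall>\<^sub>F k in sequentially. angular n f (C k) m \<le>
    f m ^ n * (\<integral>\<omega>. indicator (C k) \<omega> * exp (A * log_defect n \<omega>) \<partial>simplex_measure n)"
proof -
  obtain p q l u where *: "0 < l" "l < m" "m < u" "ln (f m) = gamma_log A p q m"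
    "\<forall>z\<in>{l<..<u}. ln (f z) \<le> gamma_log A p q z"
    using touch unfolding touches_above_def by blast
  show ?thesis
    using eventually_window[OF *(2,3) m]
  proof eventually_elim
    case (elim k)
    have C2: "cap n (1 / 2) (C k)" by (rule cap_mono[OF C]) simp
    have "(\<Prod>i\<in>{1..n}. f (m * \<omega> i)) \<le> f m ^ n * exp (A * log_defect n \<omega>)"
      if \<omega>: "\<omega> \<in> C k" "\<omega> \<in> orthant n" "avg n \<omega> = 1" for \<omega>
    proof -
      have "0 \<le> f (m * \<omega> i) \<and> f (m * \<omega> i) \<le> exp (gamma_log A p q (m * \<omega> i))" if i: "i \<in> {1..n}" for i
      proof -
        have w: "m * \<omega> i \<in> {l<..<u}" using elim capD[OF C \<omega> i] by blast
        then have "0 < f (m * \<omega> i)" using *(1) by (intro f_pos) auto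
        then show ?thesis using *(5) w by (metis exp_le_cancel_iff exp_ln less_imp_le)
      qed
      then have "(\<Prod>i\<in>{1..n}. f (m * \<omega> i)) \<le> (\<Prod>i\<in>{1..n}. exp (gamma_log A p q (m * \<omega> i)))"
        by (rule prod_mono)
      also have "\<dots> = exp (real n * ln (f m) + A * log_defect n \<omega>)"
        by (simp add: *(4) sum_gamma_log[OF n m \<omega>(2,3)] flip: exp_sum)
      also have "\<dots> = f m ^ n * exp (A * log_defect n \<omega>)"
        using f_pos[OF m] by (simp add: exp_add exp_of_nat_mult)
      finally show ?thesis .
    qed
    then have "angular n f (C k) m \<le>
      (\<integral>\<omega>. indicator (C k) \<omega> * (f m ^ n * exp (A * log_defect n \<omega>)) \<partial>simplex_measure n)"
      unfolding angular_def
      using integrable_mult_right[OF integrable_exp_log_defect[OF n C2], of "f m ^ n" A]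
      by (intro integral_mono_on_cap[OF n integrable_angular[OF n f C2 m]]) (simp_all add: mult.left_commute)
    then show ?case by (simp only: integral_indicator_mult_const)
  qed
qed

lemma angular_ge_if_touches_below:
  fixes f :: "real \<Rightarrow> real"
  assumes n: "0 < n" and f: "f \<in> borel_measurable borel" "continuous_on {0<..} f"
    and f_pos: "\<And>x. 0 < x \<Longrightarrow> 0 < f x" and m: "0 < m"
    and C: "\<And>k. cap n (1 / real (k + 2)) (C k)"
    and touch: "touches_below (\<lambda>x. ln (f x)) A m"
  shows "\<forall>\<^sub>F k in sequentially.
    f m ^ n * (\<integral>\<omega>. indicator (C k) \<omega> * exp (A * log_defect n \<omega>) \<partial>simplex_measure n)
      \<le> angular n f (C k) m"
proof -
  obtain p q l u where *: "0 < l" "l < m" "m < u" "ln (f m) = gamma_log A p q m"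
    "\<forall>z\<in>{l<..<u}. gamma_log A p q z \<le> ln (f z)"
    using touch unfolding touches_below_def by blast
  show ?thesis
    using eventually_window[OF *(2,3) m]
  proof eventually_elim
    case (elim k)
    have C2: "cap n (1 / 2) (C k)" by (rule cap_mono[OF C]) simp
    have "f m ^ n * exp (A * log_defect n \<omega>) \<le> (\<Prod>i\<in>{1..n}. f (m * \<omega> i))"
      if \<omega>: "\<omega> \<in> C k" "\<omega> \<in> orthant n" "avg n \<omega> = 1" for \<omega>
    proof -
      have le: "0 \<le> exp (gamma_log A p q (m * \<omega> i)) \<and> exp (gamma_log A p q (m * \<omega> i)) \<le> f (m * \<omega> i)"
        if i: "i \<in> {1..n}" for i
      proof -
        have w: "m * \<omega> i \<in> {l<..<u}" using elim capD[OF C \<omega> i] by blast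
        then have "0 < f (m * \<omega> i)" using *(1) by (intro f_pos) auto
        then show ?thesis using *(5) w by (metis exp_le_cancel_iff exp_ln exp_ge_zero)
      qed
      have "f m ^ n * exp (A * log_defect n \<omega>) = exp (real n * ln (f m) + A * log_defect n \<omega>)"
        using f_pos[OF m] by (simp add: exp_add exp_of_nat_mult)
      also have "\<dots> = (\<Prod>i\<in>{1..n}. exp (gamma_log A p q (m * \<omega> i)))"
        by (simp add: *(4) sum_gamma_log[OF n m \<omega>(2,3)] flip: exp_sum)
      also have "\<dots> \<le> (\<Prod>i\<in>{1..n}. f (m * \<omega> i))"
        using le by (rule prod_mono)
      finally show ?thesis .
    qed
    then have "(\<integral>\<omega>. indicator (C k) \<omega> * (f m ^ n * exp (A * log_defect n \<omega>)) \<partial>simplex_measure n)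
      \<le> angular n f (C k) m"
      unfolding angular_def
      using integrable_mult_right[OF integrable_exp_log_defect[OF n C2], of "f m ^ n" A]
      by (intro integral_mono_on_cap[OF n _ integrable_angular[OF n f C2 m]]) (simp_all add: mult.left_commute)
    then show ?case by (simp only: integral_indicator_mult_const)
  qed
qed

text \<open>
  Proportionality passes to the limit of small caps and makes every angular integral a multiple of
  \<open>f\<^sup>n\<close>. Comparing it at a point of touching from above with a point of touching from below orders the
  parameters.
\<close>

lemma gamma_log_if_angular_proportional:
  fixes f :: "real \<Rightarrow> real" and P :: "nat \<Rightarrow> real"
  assumes n: "2 \<le> n" and f: "f \<in> borel_measurable borel" "continuous_on {0<..} f"
    and f_pos: "\<And>x. 0 < x \<Longrightarrow> 0 < f x"
    and C: "\<And>k. cap n (1 / real (k + 2)) (C k)"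
    and center: "\<And>k. \<exists>D\<in>sets (Leb n). emeasure (simplex_measure n) D \<noteq> 0 \<and> (\<forall>\<omega>\<in>D. \<omega> \<in> C k \<and> \<omega> 1 \<noteq> \<omega> 2)"
    and P: "\<And>k. P k \<noteq> 0"
    and proportional: "\<And>j k r. 0 < r \<Longrightarrow> angular n f (C j) r * P k = angular n f (C k) r * P j"
  shows "\<exists>A p q. \<forall>z>0. f z = exp (gamma_log A p q z)"
proof -
  have n0: "0 < n" using n by simp
  interpret S: finite_measure "simplex_measure n" by (rule finite_simplex_measure[OF n0])
  have C2: "cap n (1 / 2) (C k)" for k by (rule cap_mono[OF C]) simp
  have pos: "0 < measure (simplex_measure n) (C k)" for k
  proof -
    obtain D where D: "D \<in> sets (Leb n)" "emeasure (simplex_measure n) D \<noteq> 0" "D \<subseteq> C k"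
      using center[of k] by blast
    have "0 < measure (simplex_measure n) D"
      using D(2) by (simp add: S.emeasure_eq_measure zero_less_measure_iff)
    also have "\<dots> \<le> measure (simplex_measure n) (C k)"
      using D C[of k] by (intro S.finite_measure_mono) (auto simp: cap_def)
    finally show ?thesis .
  qed
  (* Let the index j of the second cap tend to infinity in the proportionality of the integrals over
     the k-th and the j-th cap at the two radii. *)
  have ratio: "angular n f (C k) m * f m' ^ n = angular n f (C k) m' * f m ^ n"
    if m: "0 < m" "0 < m'" for k m m'
  proof (rule LIMSEQ_unique)
    let ?a = "\<lambda>j m. angular n f (C j) m / measure (simplex_measure n) (C j)"
    show "(\<lambda>j. angular n f (C k) m * ?a j m') \<longlonglongrightarrow> angular n f (C k) m * f m' ^ n"
      by (intro tendsto_intros angular_asymptotics[OF n0 f f_pos m(2) C pos])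
    have "angular n f (C k) m * angular n f (C j) m' = angular n f (C k) m' * angular n f (C j) m" for j
    proof -
      have "angular n f (C k) m * angular n f (C j) m' * (P j * P k)
          = (angular n f (C k) m * P j) * (angular n f (C j) m' * P k)" by simp
      also have "\<dots> = (angular n f (C j) m * P k) * (angular n f (C k) m' * P j)"
        using proportional[OF m(1), of k j] proportional[OF m(2), of j k] by simp
      finally show ?thesis using P[of j] P[of k] by simp
    qed
    then have "(\<lambda>j. angular n f (C k) m * ?a j m') = (\<lambda>j. angular n f (C k) m' * ?a j m)"
      by simp
    moreover have "(\<lambda>j. angular n f (C k) m' * ?a j m) \<longlonglongrightarrow> angular n f (C k) m' * f m ^ n"
      by (intro tendsto_intros angular_asymptotics[OF n0 f f_pos m(1) C pos])
    ultimately show "(\<lambda>j. angular n f (C k) m * ?a j m') \<longlonglongrightarrow> angular n f (C k) m' * f m ^ n"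
      by simp
  qed
  have "\<exists>A p q. \<forall>z>0. ln (f z) = gamma_log A p q z"
  proof (rule gamma_log_if_touching_ordered)
    show "continuous_on {0<..} (\<lambda>z. ln (f z))"
      using f f_pos by (intro continuous_on_ln) (auto simp: less_imp_neq[symmetric])
    fix A A' m m' assume m: "0 < m" "0 < m'"
      and "touches_above (\<lambda>z. ln (f z)) A m" "touches_below (\<lambda>z. ln (f z)) A' m'"
    let ?I = "\<lambda>A k. \<integral>\<omega>. indicator (C k) \<omega> * exp (A * log_defect n \<omega>) \<partial>simplex_measure n"
    have "\<forall>\<^sub>F k in sequentially. angular n f (C k) m \<le> f m ^ n * ?I A k \<and> f m' ^ n * ?I A' k \<le> angular n f (C k) m'"
      by (intro eventually_conj angular_le_if_touches_above[OF n0 f f_pos m(1) C]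
          angular_ge_if_touches_below[OF n0 f f_pos m(2) C]) (fact | assumption)+
    then obtain k where k: "angular n f (C k) m \<le> f m ^ n * ?I A k" "f m' ^ n * ?I A' k \<le> angular n f (C k) m'"
      by (auto simp: eventually_sequentially)
    have "f m ^ n * (f m' ^ n * ?I A' k) \<le> f m ^ n * angular n f (C k) m'"
      using k(2) f_pos[OF m(1)] by (intro mult_left_mono) auto
    also have "\<dots> = f m' ^ n * angular n f (C k) m"
      using ratio[OF m, of k] by (simp add: mult.commute)
    also have "\<dots> \<le> f m' ^ n * (f m ^ n * ?I A k)"
      using k(1) f_pos[OF m(2)] by (intro mult_left_mono) auto
    finally have "(f m ^ n * f m' ^ n) * ?I A' k \<le> (f m ^ n * f m' ^ n) * ?I A k"
      by (simp add: mult_ac)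
    then have le: "?I A' k \<le> ?I A k"
      using f_pos[OF m(1)] f_pos[OF m(2)] by simp
    show "A' \<le> A"
    proof (rule ccontr)
      assume "\<not> A' \<le> A"
      obtain D where D: "D \<in> sets (Leb n)" "emeasure (simplex_measure n) D \<noteq> 0"
        "\<And>\<omega>. \<omega> \<in> D \<Longrightarrow> \<omega> \<in> C k \<and> \<omega> 1 \<noteq> \<omega> 2"
        using center[of k] by blast
      have "?I A k < ?I A' k"
        using \<open>\<not> A' \<le> A\<close> by (intro integral_exp_log_defect_strict_mono[OF n C2 D]) auto
      with le show False by simp
    qed
  qed
  then obtain A p q where "\<And>z. 0 < z \<Longrightarrow> ln (f z) = gamma_log A p q z" by blast
  then have "f z = exp (gamma_log A p q z)" if "0 < z" for z
    using f_pos[OF that] that by (metis exp_ln)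
  then show ?thesis by blast
qed

section \<open>From independence to a gamma density\<close>

lemma nn_integral_eq_angular:
  fixes f :: "real \<Rightarrow> real" and T :: "(nat \<Rightarrow> real) \<Rightarrow> real"
  assumes n: "0 < n" and f: "f \<in> borel_measurable borel" "continuous_on {0<..} f" "\<And>x. 0 \<le> f x"
    and C: "cap n (1 / 2) {\<omega> \<in> space (Leb n). T \<omega> \<in> D}" and r: "0 < r"
  shows "(\<integral>\<^sup>+\<omega>. indicator D (T \<omega>) * (\<Prod>i\<in>{1..n}. ennreal (f (r * \<omega> i))) \<partial>simplex_measure n)
    = ennreal (angular n f {\<omega> \<in> space (Leb n). T \<omega> \<in> D} r)"
proof -
  let ?C = "{\<omega> \<in> space (Leb n). T \<omega> \<in> D}"
  have "(\<integral>\<^sup>+\<omega>. indicator D (T \<omega>) * (\<Prod>i\<in>{1..n}. ennreal (f (r * \<omega> i))) \<partial>simplex_measure n)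
      = (\<integral>\<^sup>+\<omega>. ennreal (indicator ?C \<omega> * (\<Prod>i\<in>{1..n}. f (r * \<omega> i))) \<partial>simplex_measure n)"
    using f(3) by (intro nn_integral_cong) (auto simp: prod_ennreal split: split_indicator)
  also have "\<dots> = ennreal (angular n f ?C r)"
    unfolding angular_def using f(3)
    by (intro nn_integral_eq_integral integrable_angular[OF n f(1,2) C r])
      (auto intro!: AE_I2 mult_nonneg_nonneg prod_nonneg)
  finally show ?thesis .
qed

lemma angular_pos:
  fixes f :: "real \<Rightarrow> real"
  assumes n: "0 < n" and f: "f \<in> borel_measurable borel" "continuous_on {0<..} f"
    and f_pos: "\<And>x. 0 < x \<Longrightarrow> 0 < f x"
    and C: "cap n (1 / 2) C" "emeasure (simplex_measure n) C \<noteq> 0" and r: "0 < r"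
  shows "0 < angular n f C r"
proof -
  interpret S: finite_measure "simplex_measure n" by (rule finite_simplex_measure[OF n])
  have pos: "0 < (\<Prod>i\<in>{1..n}. f (r * \<omega> i))" if "\<omega> \<in> orthant n" for \<omega>
    using that r by (intro prod_pos f_pos) (auto simp: orthant_def)
  have "(\<integral>\<omega>. 0 \<partial>simplex_measure n) < angular n f C r"
    unfolding angular_def
  proof (rule S.integral_less_AE[OF _ integrable_angular[OF n f C(1) r] C(2)])
    show "C \<in> sets (simplex_measure n)" using C(1) by (simp add: cap_def)
    show "AE \<omega> in simplex_measure n. \<omega> \<in> C \<longrightarrow> 0 \<noteq> indicator C \<omega> * (\<Prod>i\<in>{1..n}. f (r * \<omega> i))"
      using AE_simplex_measure[OF n]
    proof eventually_elim
      case (elim \<omega>)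
      then show ?case using less_imp_neq[OF pos, of \<omega>] by auto
    qed
    show "AE \<omega> in simplex_measure n. 0 \<le> indicator C \<omega> * (\<Prod>i\<in>{1..n}. f (r * \<omega> i))"
      using AE_simplex_measure[OF n]
    proof eventually_elim
      case (elim \<omega>)
      then show ?case using pos[of \<omega>] by (simp add: less_imp_le)
    qed
  qed simp
  then show ?thesis by simp
qed

text \<open>
  By independence the integral of \<open>r\<^sup>n\<^sup>-\<^sup>1 G\<^sub>k(r)\<close> over \<open>B\<close> is the probability that the mean lies in \<open>B\<close>
  times \<open>P k\<close>, the probability that the direction lies in the \<open>k\<close>-th set. So all these densities are
  multiples of each other.
\<close>

lemma angular_proportional_if_indep:
  fixes X :: "nat \<Rightarrow> 'a \<Rightarrow> real" and f :: "real \<Rightarrow> real" and T :: "(nat \<Rightarrow> real) \<Rightarrow> real"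
  assumes M: "prob_space M" and n: "0 < n"
    and indep: "prob_space.indep_vars M (\<lambda>_. borel) X {1..n}"
    and law: "\<And>i. i \<in> {1..n} \<Longrightarrow> distr M borel (X i) = density lborel (\<lambda>x. ennreal (f x))"
    and f: "f \<in> borel_measurable borel" "continuous_on {0<..} f"
    and f0: "\<And>x. x \<le> 0 \<Longrightarrow> f x = 0" and f_pos: "\<And>x. 0 < x \<Longrightarrow> 0 < f x"
    and T: "T \<in> borel_measurable (Leb n)" and T_scaled: "\<And>r y. 0 < r \<Longrightarrow> T (scaled n r y) = T y"
    and indep_T: "prob_space.indep_var M borel (sample_mean n X) borel (\<lambda>\<xi>. T (\<lambda>i\<in>{1..n}. X i \<xi>))"
    and D: "\<And>k. D k \<in> sets borel" "\<And>k. cap n (1 / 2) {\<omega> \<in> space (Leb n). T \<omega> \<in> D k}"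
    and pos: "\<And>k. emeasure (simplex_measure n) {\<omega> \<in> space (Leb n). T \<omega> \<in> D k} \<noteq> 0"
  shows "\<exists>P :: 'b \<Rightarrow> real. (\<forall>k. P k \<noteq> 0) \<and> (\<forall>j k r. 0 < r \<longrightarrow>
     angular n f {\<omega> \<in> space (Leb n). T \<omega> \<in> D j} r * P k
       = angular n f {\<omega> \<in> space (Leb n). T \<omega> \<in> D k} r * P j)"
proof -
  interpret prob_space M by fact
  interpret S: finite_measure "simplex_measure n" by (rule finite_simplex_measure[OF n])
  interpret pair_sigma_finite "simplex_measure n" lborel by standard
  note [measurable] = f(1) T D(1)
  have f_nonneg: "0 \<le> f x" for x
    using f0[of x] f_pos[of x] by (cases "0 < x") auto
  let ?TX = "\<lambda>\<xi>. T (\<lambda>i\<in>{1..n}. X i \<xi>)"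
  let ?C = "\<lambda>k. {\<omega> \<in> space (Leb n). T \<omega> \<in> D k}"
  have rv [measurable]: "sample_mean n X \<in> borel_measurable M" "?TX \<in> borel_measurable M"
    using indep_T unfolding indep_var_distribution_eq by auto
  define P where "P = (\<lambda>k. measure M {\<xi> \<in> space M. ?TX \<xi> \<in> D k})"
  define \<kappa> where "\<kappa> = (\<lambda>r::real. ennreal (r ^ (n - 1)) * indicator {0<..} r)"
  define h where "h = (\<lambda>k r. \<kappa> r * (\<integral>\<^sup>+\<omega>. indicator (D k) (T \<omega>) * (\<Prod>i\<in>{1..n}. ennreal (f (r * \<omega> i))) \<partial>simplex_measure n))"
  have [measurable]: "h k \<in> borel_measurable borel" for k
    unfolding h_def \<kappa>_def by measurable
  have h_pos: "h k r = ennreal (r ^ (n - 1)) * ennreal (angular n f (?C k) r)" if "0 < r" for k r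
    using that nn_integral_eq_angular[OF n f f_nonneg D(2) that] by (simp add: h_def \<kappa>_def)
  have ang: "0 < angular n f (?C k) r" if "0 < r" for k r
    by (rule angular_pos[OF n f f_pos D(2) pos that])
  have joint: "(\<integral>\<^sup>+r. indicator B r * h k r \<partial>lborel)
      = emeasure M {\<xi> \<in> space M. sample_mean n X \<xi> \<in> B} * ennreal (P k)"
    if B: "B \<in> sets borel" for B k
  proof -
    have "(\<integral>\<^sup>+r. indicator B r * h k r \<partial>lborel)
      = emeasure M {\<xi> \<in> space M. sample_mean n X \<xi> \<in> B \<and> ?TX \<xi> \<in> D k}"
      unfolding h_def \<kappa>_def by (rule joint_law[OF M n indep law f(1) f0 T T_scaled B D(1), symmetric])
    also have "\<dots> = emeasure M {\<xi> \<in> space M. sample_mean n X \<xi> \<in> B} * emeasure M {\<xi> \<in> space M. ?TX \<xi> \<in> D k}"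
      using indep_T B D(1) unfolding indep_var_iff_emeasure[OF rv] by blast
    finally show ?thesis by (simp add: P_def emeasure_eq_measure)
  qed
  have "P k \<noteq> 0" for k
  proof
    assume "P k = 0"
    then have "(\<integral>\<^sup>+r. h k r \<partial>lborel) = 0"
      using joint[of UNIV k] by simp
    then have ae: "AE r in lborel. h k r = 0"
      by (simp add: nn_integral_0_iff_AE)
    have "AE r in lborel. 0 < r \<longrightarrow> angular n f (?C k) r = 0"
      using ae
    proof eventually_elim
      case (elim r)
      show ?case
      proof
        assume r: "0 < r"
        then show "angular n f (?C k) r = 0"
          using elim ang[OF r, of k] by (auto simp: h_pos[OF r])
      qed
    qed
    then have "angular n f (?C k) 1 = 0"
      using continuous_AE_eq_imp_eq[OF continuous_angular[OF n f D(2)] continuous_on_const, of k 0 1]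
      by simp
    then show False using ang[of 1 k] by simp
  qed
  moreover have "angular n f (?C j) r * P k = angular n f (?C k) r * P j" if r: "0 < r" for j k r
  proof -
    have "density lborel (\<lambda>r. h j r * ennreal (P k)) = density lborel (\<lambda>r. h k r * ennreal (P j))"
    proof (rule measure_eqI)
      fix B assume "B \<in> sets (density lborel (\<lambda>r. h j r * ennreal (P k)))"
      then have B [measurable]: "B \<in> sets borel" by simp
      have "emeasure (density lborel (\<lambda>r. h j r * ennreal (P k))) B
          = (\<integral>\<^sup>+r. indicator B r * h j r * ennreal (P k) \<partial>lborel)" for j k
        by (subst emeasure_density) (auto simp: mult_ac intro!: nn_integral_cong)
      also have "\<dots> j k = emeasure M {\<xi> \<in> space M. sample_mean n X \<xi> \<in> B} * ennreal (P j) * ennreal (P k)" for j k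
        by (subst nn_integral_multc) (simp_all add: joint[OF B])
      finally show "emeasure (density lborel (\<lambda>r. h j r * ennreal (P k))) B
          = emeasure (density lborel (\<lambda>r. h k r * ennreal (P j))) B"
        by (simp add: mult_ac)
    qed simp
    then have ae: "AE r in lborel. h j r * ennreal (P k) = h k r * ennreal (P j)"
      by (intro sigma_finite_measure.density_unique[OF sigma_finite_lborel]) auto
    have "AE r in lborel. 0 < r \<longrightarrow> angular n f (?C j) r * P k = angular n f (?C k) r * P j"
      using ae
    proof eventually_elim
      case (elim s)
      show ?case
      proof
        assume s: "0 < s"
        have "ennreal (s ^ (n - 1) * (angular n f (?C j) s * P k)) = ennreal (s ^ (n - 1) * (angular n f (?C k) s * P j))"
          using elim s ang[OF s, of j] ang[OF s, of k]
          by (simp add: h_pos[OF s] P_def mult.assoc ennreal_mult'')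
        then show "angular n f (?C j) s * P k = angular n f (?C k) s * P j"
          using s ang[OF s, of j] ang[OF s, of k] by (subst (asm) ennreal_inj) (auto simp: P_def)
      qed
    qed
    then show ?thesis
      using r by (intro continuous_AE_eq_imp_eq[of "\<lambda>r. angular n f (?C j) r * P k" "\<lambda>r. angular n f (?C k) r * P j"])
        (auto intro!: continuous_on_mult_right continuous_angular[OF n f D(2)])
  qed
  ultimately show ?thesis by (intro exI[of _ P]) blast
qed

section \<open>The ratio of the linear statistic and the mean\<close>

definition L_ratio :: "nat \<Rightarrow> (nat \<Rightarrow> real) \<Rightarrow> (nat \<Rightarrow> real) \<Rightarrow> real" where
  "L_ratio n a y = L_stat n a (\<lambda>i y. y i) y / avg n y"

lemma L_ratio_measurable: "L_ratio n a \<in> borel_measurable (Leb n)"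
proof -
  have [measurable]: "L_stat n a (\<lambda>i y. y i) \<in> borel_measurable (Leb n)"
    by (rule measurable_L_stat) measurable
  show ?thesis unfolding L_ratio_def[abs_def] by measurable
qed

lemma L_ratio_scaled:
  assumes "0 < r"
  shows "L_ratio n a (scaled n r y) = L_ratio n a y"
proof -
  have "L_stat n a (\<lambda>i y. y i) (scaled n r y) = r * L_stat n a (\<lambda>i y. y i) y"
    by (rule L_stat_scale[OF assms]) simp
  then show ?thesis using assms by (simp add: L_ratio_def avg_scaled)
qed

lemma L_ratio_sample: "L_ratio n a (\<lambda>i\<in>{1..n}. X i \<xi>) = L_stat n a X \<xi> / sample_mean n X \<xi>"
proof -
  have "L_stat n a (\<lambda>i y. y i) (\<lambda>i\<in>{1..n}. X i \<xi>) = 1 * L_stat n a X \<xi>"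
    by (rule L_stat_scale) auto
  moreover have "avg n (\<lambda>i\<in>{1..n}. X i \<xi>) = 1 * sample_mean n X \<xi>"
    by (rule sample_mean_scale) simp
  ultimately show ?thesis by (simp add: L_ratio_def)
qed

text \<open>
  On the simplex the mean is 1 and lies between the extreme order statistics, so each coordinate
  differs from 1 by at most the range, which the statistic controls.
\<close>

lemma cap_L_ratio:
  assumes n: "2 \<le> n" and a: "mono_on {1..n} a" "a 1 < a n" and d: "0 < d"
  shows "cap n d {\<omega> \<in> space (Leb n). L_ratio n a \<omega> \<in> {..(a n - a 1) / real n * d}}"
  unfolding cap_def
proof (intro conjI ballI impI)
  note [measurable] = L_ratio_measurable
  show "{\<omega> \<in> space (Leb n). L_ratio n a \<omega> \<in> {..(a n - a 1) / real n * d}} \<in> sets (Leb n)"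
    by measurable
  fix \<omega> i
  assume \<omega>: "\<omega> \<in> {\<omega> \<in> space (Leb n). L_ratio n a \<omega> \<in> {..(a n - a 1) / real n * d}}" "avg n \<omega> = 1"
    and i: "i \<in> {1..n}"
  let ?lo = "order_stat n (\<lambda>i y. y i) 1 \<omega>" and ?hi = "order_stat n (\<lambda>i y. y i) n \<omega>"
  have "(a n - a 1) * (?hi - ?lo) \<le> real n * L_stat n a (\<lambda>i y. y i) \<omega>"
    by (rule spread_le_L_stat[OF n a(1)])
  also have "\<dots> \<le> real n * ((a n - a 1) / real n * d)"
    using \<omega> by (intro mult_left_mono) (auto simp: L_ratio_def)
  also have "\<dots> = (a n - a 1) * d" using n by simp
  finally have "?hi - ?lo \<le> d" using a(2) by simp
  moreover have "?lo \<le> \<omega> i" "\<omega> i \<le> ?hi"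
    using between_extreme_order_stats[OF i, of "\<lambda>i y. y i" \<omega>] by auto
  moreover have "?lo \<le> 1" "1 \<le> ?hi"
    using sample_mean_between[of n ?lo "\<lambda>i y. y i" \<omega> ?hi] between_extreme_order_stats[of _ n "\<lambda>i y. y i" \<omega>] n \<omega>(2)
    by auto
  ultimately show "\<bar>\<omega> i - 1\<bar> \<le> d" by linarith
qed

text \<open>
  The factor 4 in the choice of \<open>\<delta>\<close> is a range of \<open>2 \<delta>\<close>, divided by a mean of at least 1/2.
\<close>

lemma L_ratio_small_near_center:
  assumes n: "2 \<le> n" and e: "0 < e"
  shows "\<exists>D\<in>sets (Leb n). emeasure (simplex_measure n) D \<noteq> 0 \<and>
    (\<forall>\<omega>\<in>D. \<omega> \<in> {\<omega> \<in> space (Leb n). L_ratio n a \<omega> \<in> {..e}} \<and> \<omega> 1 \<noteq> \<omega> 2)"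
proof -
  define s where "s = (\<Sum>i = 1..n. \<bar>a i\<bar>)"
  have s: "0 \<le> s" by (simp add: s_def sum_nonneg)
  define \<delta> where "\<delta> = min (1 / 2) (e / (4 * s + 1))"
  have \<delta>: "0 < \<delta>" "\<delta> \<le> 1 / 2"
    using e s unfolding \<delta>_def by (simp_all only: min.cobounded1) auto
  have "\<delta> \<le> e / (4 * s + 1)" by (simp add: \<delta>_def)
  then have "\<delta> * (4 * s + 1) \<le> e" using s by (subst (asm) pos_le_divide_eq) auto
  then have e_bound: "4 * s * \<delta> \<le> e" using \<delta> by (simp add: algebra_simps)
  let ?D = "{\<omega> \<in> space (Leb n). (\<forall>i\<in>{1..n}. \<bar>\<omega> i - 1\<bar> \<le> \<delta>) \<and> \<omega> 1 \<noteq> \<omega> 2}"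
  have pos: "emeasure (simplex_measure n) ?D \<noteq> 0"
    by (rule simplex_measure_near_center[OF n \<delta>(1)])
  have "?D \<in> sets (Leb n)"
    using pos emeasure_notin_sets[of ?D "simplex_measure n"] by auto
  moreover have "L_ratio n a \<omega> \<le> e" if \<omega>: "\<omega> \<in> ?D" for \<omega>
  proof -
    have b: "1 - \<delta> \<le> \<omega> i" "\<omega> i \<le> 1 + \<delta>" if "i \<in> {1..n}" for i
    proof -
      have "\<bar>\<omega> i - 1\<bar> \<le> \<delta>" using \<omega> that by blast
      then show "1 - \<delta> \<le> \<omega> i" "\<omega> i \<le> 1 + \<delta>" by linarith+
    qed
    have n0: "0 < n" using n by simp
    have m: "1 / 2 \<le> avg n \<omega>"
      using sample_mean_between(1)[of n "1 - \<delta>" "\<lambda>i y. y i" \<omega>, OF n0 b] \<delta>(2) by simp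
    have "L_stat n a (\<lambda>i y. y i) \<omega> \<le> s * ((1 + \<delta>) - (1 - \<delta>))"
      unfolding s_def
      by (rule L_stat_le_spread[where X = "\<lambda>i y. y i" and \<omega> = \<omega>, OF n0 b])
    also have "\<dots> = 4 * s * \<delta> * (1 / 2)" by (simp add: algebra_simps)
    also have "\<dots> \<le> e * avg n \<omega>"
      using e_bound m e by (intro mult_mono) auto
    finally show ?thesis using m by (simp add: L_ratio_def pos_divide_le_eq)
  qed
  ultimately show ?thesis using pos by (intro bexI[of _ ?D]) auto
qed

theorem corollary2:
  fixes M :: "'a measure" and X :: "nat \<Rightarrow> 'a \<Rightarrow> real" and n :: nat
    and F :: "real measure" and f :: "real \<Rightarrow> real" and a :: "nat \<Rightarrow> real"
  assumes "prob_space M"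
    and "n \<ge> 3"
    and "prob_space.indep_vars M (\<lambda>_. borel) X {1..n}"
    and "\<And>i. i \<in> {1..n} \<Longrightarrow> distr M borel (X i) = F"
    and "\<And>i. i \<in> {1..n} \<Longrightarrow> AE \<omega> in M. 0 < X i \<omega>"
    and "f \<in> borel_measurable borel"
    and "\<And>x. 0 \<le> f x"
    and "F = density lborel (\<lambda>x. ennreal (f x))"
    and "\<And>x. 0 < x \<Longrightarrow> 0 < f x"
    and "continuous_on {0<..} f"
    and "mono_on {1..n} a"
    and "\<exists>i\<in>{1..n}. \<exists>j\<in>{1..n}. a i \<noteq> a j"
  shows "prob_space.indep_var M
           borel (sample_mean n X)
           borel (\<lambda>\<omega>. L_stat n a X \<omega> / sample_mean n X \<omega>)
         \<longleftrightarrow> gamma_distribution F"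
proof
  have n: "0 < n" "2 \<le> n" using assms(2) by auto
  interpret prob_space M by fact
  note [measurable] = assms(6)
  assume indep: "prob_space.indep_var M borel (sample_mean n X)
    borel (\<lambda>\<omega>. L_stat n a X \<omega> / sample_mean n X \<omega>)"
  (* Positivity of the sample makes f vanish almost everywhere on the negative axis; g is the
     version that vanishes there everywhere, so that its products live on the orthant. *)
  define g where "g = (\<lambda>x. if 0 < x then f x else 0)"
  have g_meas [measurable]: "g \<in> borel_measurable borel"
    unfolding g_def by measurable
  have X1: "X 1 \<in> borel_measurable M"
    using assms(3) n by (auto simp: indep_vars_def)
  have "AE x in F. 0 < x"
    using assms(4)[of 1] assms(5)[of 1] n X1 AE_distr_iff[of "X 1" M borel "\<lambda>x. 0 < x"] by auto
  then have "AE x in lborel. 0 < f x \<longrightarrow> 0 < x"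
    unfolding assms(8) by (subst (asm) AE_density) auto
  then have "AE x in lborel. ennreal (f x) = ennreal (g x)"
  proof eventually_elim
    case (elim x)
    then show ?case using assms(7)[of x] by (auto simp: g_def)
  qed
  then have F: "F = density lborel (\<lambda>x. ennreal (g x))"
    unfolding assms(8) by (intro density_cong) auto
  have law: "distr M borel (X i) = density lborel (\<lambda>x. ennreal (g x))" if "i \<in> {1..n}" for i
    using assms(4)[OF that] F by simp
  have g_cont: "continuous_on {0<..} g"
    using assms(10) by (rule continuous_on_eq) (simp add: g_def)
  have g0: "g x = 0" if "x \<le> 0" for x using that by (simp add: g_def)
  have g_pos: "0 < g x" if "0 < x" for x using that assms(9) by (simp add: g_def)
  have a: "a 1 < a n"
  proof -
    obtain i j where ij: "i \<in> {1..n}" "j \<in> {1..n}" "a i \<noteq> a j" using assms(12) by blast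
    have "a 1 \<le> a k \<and> a k \<le> a n" if "k \<in> {1..n}" for k
      using that n by (auto intro!: mono_onD[OF assms(11)])
    from this[OF ij(1)] this[OF ij(2)] ij(3) show ?thesis by linarith
  qed
  (* These thresholds force the directions into caps of radius 1 / (k + 2), hence at most 1 / 2. *)
  define D where "D = (\<lambda>k::nat. {..(a n - a 1) / real n * (1 / real (k + 2))})"
  let ?C = "\<lambda>k. {\<omega> \<in> space (Leb n). L_ratio n a \<omega> \<in> D k}"
  have cap: "cap n (1 / real (k + 2)) (?C k)" for k
    unfolding D_def by (rule cap_L_ratio[OF n(2) assms(11) a]) simp
  have cap2: "cap n (1 / 2) (?C k)" for k
    by (rule cap_mono[OF cap]) simp
  have center: "\<exists>D\<in>sets (Leb n). emeasure (simplex_measure n) D \<noteq> 0 \<and> (\<forall>\<omega>\<in>D. \<omega> \<in> ?C k \<and> \<omega> 1 \<noteq> \<omega> 2)" for k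
    unfolding D_def using a n by (intro L_ratio_small_near_center[OF n(2)]) auto
  have C_pos: "emeasure (simplex_measure n) (?C k) \<noteq> 0" for k
  proof -
    obtain E where E: "emeasure (simplex_measure n) E \<noteq> 0" "E \<subseteq> ?C k"
      using center[of k] by blast
    then show ?thesis
      using emeasure_mono[OF E(2), of "simplex_measure n"] cap[of k] by (auto simp: cap_def)
  qed
  have indep': "indep_var borel (sample_mean n X) borel (\<lambda>\<xi>. L_ratio n a (\<lambda>i\<in>{1..n}. X i \<xi>))"
    using indep by (simp add: L_ratio_sample)
  have D: "D k \<in> sets borel" for k by (simp add: D_def)
  obtain P where P: "\<And>k. P k \<noteq> 0"
    "\<And>j k r. 0 < r \<Longrightarrow> angular n g (?C j) r * P k = angular n g (?C k) r * P j"
    using angular_proportional_if_indep[where D = D, OF assms(1) n(1) assms(3) law g_meas g_cont g0 g_pos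
        L_ratio_measurable L_ratio_scaled indep' D cap2 C_pos] by blast
  obtain A p q where "\<And>z. 0 < z \<Longrightarrow> g z = exp (gamma_log A p q z)"
    using gamma_log_if_angular_proportional[OF n(2) g_meas g_cont g_pos cap center P] by blast
  moreover have "prob_space (density lborel (\<lambda>x. ennreal (g x)))"
    using prob_space_distr[OF X1] law[of 1] n by simp
  ultimately show "gamma_distribution F"
    unfolding F by (intro gamma_distribution_if_gamma_log[OF g_meas _ g0])
next
  have n: "0 < n" using assms(2) by auto
  assume "gamma_distribution F"
  then obtain c b where cb: "0 < c" "0 < b" and F: "F = density lborel (\<lambda>x. ennreal (gamma_density c b x))"
    unfolding gamma_distribution_def by blast
  have "prob_space.indep_var M borel (sample_mean n X) borel (\<lambda>\<xi>. L_ratio n a (\<lambda>i\<in>{1..n}. X i \<xi>))"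
  proof (rule indep_if_density_factors[OF assms(1) n assms(3) _ gamma_density_measurable _ L_ratio_measurable L_ratio_scaled])
    show "distr M borel (X i) = density lborel (\<lambda>x. ennreal (gamma_density c b x))" if "i \<in> {1..n}" for i
      using assms(4)[OF that] F by simp
    show "gamma_density c b x = 0" if "x \<le> 0" for x
      using that by (simp add: gamma_density_def)
    show "(\<Prod>i\<in>{1..n}. ennreal (gamma_density c b (r * \<omega> i))) =
        ennreal ((1 / (Gamma c * b powr c) * r powr (c - 1)) ^ n * exp (- real n * r / b))
          * ennreal (\<Prod>i\<in>{1..n}. \<omega> i powr (c - 1))"
      if "0 < r" "\<omega> \<in> orthant n" "avg n \<omega> = 1" for r \<omega>
      by (rule prod_gamma_density[OF that n cb])
  qed measurable
  then show "prob_space.indep_var M borel (sample_mean n X)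
    borel (\<lambda>\<omega>. L_stat n a X \<omega> / sample_mean n X \<omega>)"
    by (simp add: L_ratio_sample)
qed

end
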